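(* Let $W$ be a generic elliptic family of bisectors. Then the focal map $f:E_W\to\mathbb P_{\mathbb C}V$ can be extended to an isomorphism $\hat f:\hat E_W\to E\subset\mathbb P_{\mathbb C}V$ between complex plane cubics (where $E$ is a plane cubic in $\mathbb P_{\mathbb C}V$).
   Context: $V$ is a 3-dimensional $\mathbb C$-linear space with a hermitian form $\langle-,-\rangle$ (linear in the first argument) of signature $++-$. $\mathbb B=\{p\in\mathbb P_{\mathbb C}V\mid\langle p,p\rangle<0\}$. $\mathrm{Lin}_{\mathbb C}(V,V)$ is the space of $\mathbb C$-linear maps $V\to V$; $h^*$ is the adjoint of $h$ with respect to $\langle-,-\rangle$. A family of bisectors is an $\mathbb R$-linear subspace $W\subset\mathrm{Lin}_{\mathbb C}(V,V)$ such that $\operatorname{tr}h=0$ and $h^*=h$ for all $h\in W$, $W$ is the $\mathbb R$-span of $D_W:=\{h\in W\mid\det h=0\}$, and there is $p\in\mathbb B$ with $\langle hp,p\rangle=0$ for all $h\in W$. Every $0\ne h\in D_W$ has rank 2. $E_W\subset\mathbb P_{\mathbb R}W$ is the image of $D_W$, given by the equation $\det=0$. The focal map $f:E_W\to\mathbb P_{\mathbb C}V$ sends $h$ to its focus $\mathbb P_{\mathbb C}\ker h$. The family is elliptic if $\dim_{\mathbb R}W=3$ and $D_W\ne W$; then $E_W$ is a real plane cubic, and $\hat E_W\subset\mathbb P_{\mathbb C}(\mathbb CW)$ denotes the corresponding complex plane cubic, where $\mathbb CW=W+iW\subset\mathrm{Lin}_{\mathbb C}(V,V)$ (and $W\cap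 iW=0$). A confocal line in $E_W$ is a real projective line $\mathbb P_{\mathbb R}L\subset E_W$, $\dim_{\mathbb R}L=2$, such that $Lf_0=0$ for some $0\ne f_0\in V$. An elliptic family $W$ is generic if $E_W$ contains no confocal line and $E_W$ is not a real projective line plus a point. *)

theory Defs
  imports "HOL-Analysis.Analysis"
begin

section \<open>Projective spaces and plane cubics\<close>

text \<open>
  A vector space is given by its scalar multiplication \<open>s\<close>, so that the same notions apply to
  real and complex scalars, and to a subspace \<open>U\<close> of a space of vectors or of matrices.
  A point of the projectivization of \<open>U\<close> is the line (through 0) spanned by a nonzero vector.
\<close>

definition line :: "('k::field \<Rightarrow> 'a::ab_group_add \<Rightarrow> 'a) \<Rightarrow> 'a \<Rightarrow> 'a set" where
  "line s x = range (\<lambda>c. s c x)"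

definition proj :: "('k::field \<Rightarrow> 'a::ab_group_add \<Rightarrow> 'a) \<Rightarrow> 'a set \<Rightarrow> 'a set set" where
  "proj s U = line s ` (U - {0})"

definition proj_zeros ::
  "('k::field \<Rightarrow> 'a::ab_group_add \<Rightarrow> 'a) \<Rightarrow> 'a set \<Rightarrow> ('a \<Rightarrow> complex) \<Rightarrow> 'a set set" where
  "proj_zeros s U F = proj s {x \<in> U. F x = 0}"

text \<open>
  \<open>homogeneous s d F\<close>: \<open>F\<close> is a homogeneous polynomial function of degree \<open>d\<close>
  (0 counts as homogeneous of every degree). As the field is infinite, polynomials on a
  subspace \<open>U\<close> are identified with the restrictions to \<open>U\<close> of such functions.
\<close>

inductive homogeneous ::
  "(complex \<Rightarrow> 'a::ab_group_add \<Rightarrow> 'a) \<Rightarrow> nat \<Rightarrow> ('a \<Rightarrow> complex) \<Rightarrow> bool"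
  for s where
  const: "homogeneous s 0 (\<lambda>x. c)"
| linear: "Vector_Spaces.linear s (*) l \<Longrightarrow> homogeneous s 1 l"
| add: "homogeneous s d F \<Longrightarrow> homogeneous s d G \<Longrightarrow> homogeneous s d (\<lambda>x. F x + G x)"
| mult: "homogeneous s d F \<Longrightarrow> homogeneous s e G \<Longrightarrow> homogeneous s (d + e) (\<lambda>x. F x * G x)"

definition homogeneous_map ::
  "(complex \<Rightarrow> 'a::ab_group_add \<Rightarrow> 'a) \<Rightarrow> (complex \<Rightarrow> 'b::ab_group_add \<Rightarrow> 'b) \<Rightarrow>
   nat \<Rightarrow> ('a \<Rightarrow> 'b) \<Rightarrow> bool" where
  "homogeneous_map s t d \<phi> \<longleftrightarrow>
     (\<forall>l. Vector_Spaces.linear t (*) l \<longrightarrow> homogeneous s d (\<lambda>x. l (\<phi> x)))"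

definition plane_cubic ::
  "(complex \<Rightarrow> 'a::ab_group_add \<Rightarrow> 'a) \<Rightarrow> 'a set \<Rightarrow> ('a \<Rightarrow> complex) \<Rightarrow> bool" where
  "plane_cubic s U F \<longleftrightarrow>
     module.subspace s U \<and> vector_space.dim s U = 3 \<and>
     homogeneous s 3 F \<and> (\<exists>x\<in>U. F x \<noteq> 0)"

text \<open>
  A plane cubic may be singular, reducible or non-reduced. It is therefore treated as the
  subscheme \<open>F = 0\<close> of the projective plane, and not just as the set of its points: identities
  between regular functions are required modulo the equation \<open>F\<close>. The form \<open>A\<close> represents
  zero in the local ring of the cubic at the point \<open>[x]\<close> iff \<open>S * A = F * K\<close> on \<open>U\<close> for
  some forms \<open>S\<close>, \<open>K\<close> with \<open>S x \<noteq> 0\<close>. For a reduced cubic, this says that \<open>A\<close> vanishes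
  at all points of the cubic in a Zariski neighbourhood of \<open>[x]\<close>.
\<close>

definition zero_mod_at ::
  "(complex \<Rightarrow> 'a::ab_group_add \<Rightarrow> 'a) \<Rightarrow> 'a set \<Rightarrow> ('a \<Rightarrow> complex) \<Rightarrow> 'a \<Rightarrow>
   ('a \<Rightarrow> complex) \<Rightarrow> bool" where
  "zero_mod_at s U F x A \<longleftrightarrow>
     (\<exists>d e S K. homogeneous s d S \<and> homogeneous s e K \<and> S x \<noteq> 0 \<and>
        (\<forall>y\<in>U. S y * A y = F y * K y))"

text \<open>
  The maps to a projective space that are given in homogeneous coordinates by \<open>\<phi>\<close> and \<open>\<psi>\<close>
  agree on the cubic near \<open>[x]\<close>: the 2 by 2 minors of \<open>(\<phi>, \<psi>)\<close> represent zero.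
\<close>

definition agree_at ::
  "(complex \<Rightarrow> 'a::ab_group_add \<Rightarrow> 'a) \<Rightarrow> 'a set \<Rightarrow> ('a \<Rightarrow> complex) \<Rightarrow>
   (complex \<Rightarrow> 'b::ab_group_add \<Rightarrow> 'b) \<Rightarrow> 'a \<Rightarrow> ('a \<Rightarrow> 'b) \<Rightarrow> ('a \<Rightarrow> 'b) \<Rightarrow> bool" where
  "agree_at s U F t x \<phi> \<psi> \<longleftrightarrow>
     (\<forall>l m. Vector_Spaces.linear t (*) l \<longrightarrow> Vector_Spaces.linear t (*) m \<longrightarrow>
        zero_mod_at s U F x (\<lambda>y. l (\<phi> y) * m (\<psi> y) - m (\<phi> y) * l (\<psi> y)))"

text \<open>
  \<open>\<Phi>\<close> represents a morphism from the cubic \<open>F = 0\<close> in the plane of \<open>U\<close> to the cubic \<open>G = 0\<close>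
  in the plane of \<open>U'\<close>. Each \<open>\<phi> \<in> \<Phi>\<close> gives the morphism in homogeneous coordinates on the open
  set \<open>\<phi> \<noteq> 0\<close>; these open sets cover the cubic, and the members of \<open>\<Phi>\<close> agree on overlaps.
\<close>

definition cubic_morphism ::
  "(complex \<Rightarrow> 'a::ab_group_add \<Rightarrow> 'a) \<Rightarrow> 'a set \<Rightarrow> ('a \<Rightarrow> complex) \<Rightarrow>
   (complex \<Rightarrow> 'b::ab_group_add \<Rightarrow> 'b) \<Rightarrow> 'b set \<Rightarrow> ('b \<Rightarrow> complex) \<Rightarrow> ('a \<Rightarrow> 'b) set \<Rightarrow> bool" where
  "cubic_morphism s U F t U' G \<Phi> \<longleftrightarrow>
     (\<forall>\<phi>\<in>\<Phi>. \<phi> ` U \<subseteq> U' \<and> (\<exists>d. homogeneous_map s t d \<phi>)) \<and>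
     (\<forall>x\<in>U - {0}. F x = 0 \<longrightarrow>
        (\<exists>\<phi>\<in>\<Phi>. \<phi> x \<noteq> 0) \<and>
        (\<forall>\<phi>\<in>\<Phi>. \<phi> x \<noteq> 0 \<longrightarrow> zero_mod_at s U F x (\<lambda>y. G (\<phi> y))) \<and>
        (\<forall>\<phi>\<in>\<Phi>. \<forall>\<psi>\<in>\<Phi>. \<phi> x \<noteq> 0 \<longrightarrow> \<psi> x \<noteq> 0 \<longrightarrow> agree_at s U F t x \<phi> \<psi>))"

definition left_inverse_on_cubic ::
  "(complex \<Rightarrow> 'a::ab_group_add \<Rightarrow> 'a) \<Rightarrow> 'a set \<Rightarrow> ('a \<Rightarrow> complex) \<Rightarrow>
   ('b::ab_group_add \<Rightarrow> 'a) set \<Rightarrow> ('a \<Rightarrow> 'b) set \<Rightarrow> bool" where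
  "left_inverse_on_cubic s U F \<Psi> \<Phi> \<longleftrightarrow>
     (\<forall>x\<in>U - {0}. F x = 0 \<longrightarrow>
        (\<forall>\<phi>\<in>\<Phi>. \<forall>\<psi>\<in>\<Psi>. \<phi> x \<noteq> 0 \<longrightarrow> \<psi> (\<phi> x) \<noteq> 0 \<longrightarrow>
           agree_at s U F s x (\<lambda>y. \<psi> (\<phi> y)) (\<lambda>y. y)))"

text \<open>
  The map \<open>f\<close> between the points of the plane cubics \<open>F = 0\<close> and \<open>G = 0\<close> underlies an
  isomorphism of these cubics. In particular, \<open>f\<close> is then a bijection from \<open>proj_zeros s U F\<close>
  to \<open>proj_zeros t U' G\<close>.
\<close>

definition cubic_isomorphism ::
  "(complex \<Rightarrow> 'a::ab_group_add \<Rightarrow> 'a) \<Rightarrow> 'a set \<Rightarrow> ('a \<Rightarrow> complex) \<Rightarrow>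
   (complex \<Rightarrow> 'b::ab_group_add \<Rightarrow> 'b) \<Rightarrow> 'b set \<Rightarrow> ('b \<Rightarrow> complex) \<Rightarrow>
   ('a set \<Rightarrow> 'b set) \<Rightarrow> bool" where
  "cubic_isomorphism s U F t U' G f \<longleftrightarrow>
     plane_cubic s U F \<and> plane_cubic t U' G \<and>
     (\<exists>\<Phi> \<Psi>. cubic_morphism s U F t U' G \<Phi> \<and> cubic_morphism t U' G s U F \<Psi> \<and>
        left_inverse_on_cubic s U F \<Psi> \<Phi> \<and> left_inverse_on_cubic t U' G \<Phi> \<Psi> \<and>
        (\<forall>\<phi>\<in>\<Phi>. \<forall>x\<in>U - {0}. F x = 0 \<longrightarrow> \<phi> x \<noteq> 0 \<longrightarrow> f (line s x) = line t (\<phi> x)))"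


section \<open>Families of bisectors\<close>

text \<open>
  \<open>V\<close> is \<open>complex^3\<close> with an arbitrary hermitian form \<open>H\<close> of signature \<open>++-\<close>, and linear
  endomorphisms of \<open>V\<close> are 3 by 3 matrices acting by \<open>*v\<close>.
\<close>

type_synonym vec3 = "complex^3"
type_synonym mat3 = "complex^3^3"

definition hermitian_form :: "(vec3 \<Rightarrow> vec3 \<Rightarrow> complex) \<Rightarrow> bool" where
  "hermitian_form H \<longleftrightarrow>
     (\<forall>y. Vector_Spaces.linear (*s) (*) (\<lambda>x. H x y)) \<and> (\<forall>x y. H y x = cnj (H x y))"

text \<open>Vectors \<open>e1\<close>, \<open>e2\<close>, \<open>e3\<close> as below automatically form a basis.\<close>

definition signature_ppm :: "(vec3 \<Rightarrow> vec3 \<Rightarrow> complex) \<Rightarrow> bool" where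
  "signature_ppm H \<longleftrightarrow>
     (\<exists>e1 e2 e3. H e1 e1 = 1 \<and> H e2 e2 = 1 \<and> H e3 e3 = -1 \<and>
        H e1 e2 = 0 \<and> H e1 e3 = 0 \<and> H e2 e3 = 0)"

definition adjoint_wrt :: "(vec3 \<Rightarrow> vec3 \<Rightarrow> complex) \<Rightarrow> mat3 \<Rightarrow> mat3 \<Rightarrow> bool" where
  "adjoint_wrt H h k \<longleftrightarrow> (\<forall>x y. H (h *v x) y = H x (k *v y))"

definition degenerate_part :: "mat3 set \<Rightarrow> mat3 set" where
  "degenerate_part W = {h \<in> W. det h = 0}"

definition bisector_family :: "(vec3 \<Rightarrow> vec3 \<Rightarrow> complex) \<Rightarrow> mat3 set \<Rightarrow> bool" where
  "bisector_family H W \<longleftrightarrow>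
     subspace W \<and>
     (\<forall>h\<in>W. trace h = 0 \<and> adjoint_wrt H h h) \<and>
     span (degenerate_part W) = W \<and>
     (\<exists>p. Re (H p p) < 0 \<and> (\<forall>h\<in>W. H (h *v p) p = 0))"

definition elliptic_family :: "(vec3 \<Rightarrow> vec3 \<Rightarrow> complex) \<Rightarrow> mat3 set \<Rightarrow> bool" where
  "elliptic_family H W \<longleftrightarrow> bisector_family H W \<and> dim W = 3 \<and> degenerate_part W \<noteq> W"

definition real_cubic :: "mat3 set \<Rightarrow> mat3 set set" where
  "real_cubic W = proj_zeros scaleR W det"

text \<open>The focus of a real point \<open>[h]\<close> of the cubic is the point \<open>ker h\<close> of the projective plane.\<close>

definition focal_map :: "mat3 set \<Rightarrow> vec3 set" where
  "focal_map P = {v. \<forall>h\<in>P. h *v v = 0}"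

definition confocal_line :: "mat3 set \<Rightarrow> mat3 set \<Rightarrow> bool" where
  "confocal_line W L \<longleftrightarrow>
     subspace L \<and> L \<subseteq> W \<and> dim L = 2 \<and> proj scaleR L \<subseteq> real_cubic W \<and>
     (\<exists>v. v \<noteq> 0 \<and> (\<forall>h\<in>L. h *v v = 0))"

definition line_plus_point :: "mat3 set \<Rightarrow> bool" where
  "line_plus_point W \<longleftrightarrow>
     (\<exists>L h. subspace L \<and> L \<subseteq> W \<and> dim L = 2 \<and> h \<in> W \<and> h \<notin> L \<and>
        real_cubic W = insert (line scaleR h) (proj scaleR L))"

definition generic_elliptic_family :: "(vec3 \<Rightarrow> vec3 \<Rightarrow> complex) \<Rightarrow> mat3 set \<Rightarrow> bool" where
  "generic_elliptic_family H W \<longleftrightarrow>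
     elliptic_family H W \<and> (\<nexists>L. confocal_line W L) \<and> \<not> line_plus_point W"

definition cscale :: "complex \<Rightarrow> mat3 \<Rightarrow> mat3" where
  "cscale c A = (\<chi> i. c *s A $ i)"

definition complexification :: "mat3 set \<Rightarrow> mat3 set" where
  "complexification W = {A + cscale \<i> B | A B. A \<in> W \<and> B \<in> W}"

end

theory Submission
  imports Defs
begin

text \<open>
  Choosing a basis \<open>h1, h2, h3\<close> of \<open>W\<close>, the action \<open>(h, v) \<mapsto> h v\<close> is a 3 by 3 by 3 tensor, which is
  also a matrix \<open>N v\<close> of linear forms in \<open>v\<close>, with columns \<open>h1 v, h2 v, h3 v\<close>. So \<open>h v = 0\<close> says that
  the coordinates of \<open>h\<close> are in the kernel of \<open>N v\<close>, and the focal map has the inverse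
  \<open>v \<mapsto> ker (N v)\<close>, from the cubic \<open>det (N v) = 0\<close>. Both kernels are given by the columns of the
  adjugates, wherever the ranks are 2; the identities needed hold exactly modulo the determinants.

  The ranks are 2 because \<open>W\<close> is generic. A rank one element of the complexification and its adjoint
  have a common kernel, which gives a confocal line. If \<open>N v\<close> has rank one,
  then a pencil of elements kills \<open>v\<close>: either its real points form a confocal line, or the pencil and
  its adjoint are two conjugate lines of the cubic, whose real points are a line plus a point. Finally,
  \<open>det (N v)\<close> is not identically zero: otherwise the elements of the complexification are linearly
  dependent at every vector, which forces an element of rank one or two invariant planes, whose
  intersection \<open>v\<close> has \<open>N v\<close> of rank one.
\<close>

section \<open>Cross products over the complex numbers\<close>

text \<open>All products in this section are complex bilinear, without conjugation, so that their
  entries are polynomials.\<close>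

definition cross :: "vec3 \<Rightarrow> vec3 \<Rightarrow> vec3" where
  "cross x y = vector [x$2 * y$3 - x$3 * y$2, x$3 * y$1 - x$1 * y$3, x$1 * y$2 - x$2 * y$1]"

definition cdot :: "vec3 \<Rightarrow> vec3 \<Rightarrow> complex" where
  "cdot x y = x$1 * y$1 + x$2 * y$2 + x$3 * y$3"

definition trip :: "vec3 \<Rightarrow> vec3 \<Rightarrow> vec3 \<Rightarrow> complex" where
  "trip x y z = cdot x (cross y z)"

text \<open>The Levi-Civita symbol.\<close>

definition levi :: "3 \<Rightarrow> 3 \<Rightarrow> 3 \<Rightarrow> complex" where
  "levi a b c = trip (axis a 1) (axis b 1) (axis c 1)"

lemma cross_components:
  "cross x y $ 1 = x$2 * y$3 - x$3 * y$2"
  "cross x y $ 2 = x$3 * y$1 - x$1 * y$3"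
  "cross x y $ 3 = x$1 * y$2 - x$2 * y$1"
  by (simp_all add: cross_def)

lemmas cross_defs = cross_components cdot_def trip_def vec_eq_iff forall_3 algebra_simps

lemma mat_vec_component: "(M *v x) $ i = cdot (M $ i) x" for M :: mat3
  by (simp add: matrix_vector_mult_def sum_3 cdot_def)

text \<open>Both sides alternate in the rows. Since repeated and reordered indices are allowed, one
  formula treats all minors at once.\<close>

lemma trip_rows: "trip (M $ a) (M $ b) (M $ c) = levi a b c * det M" for M :: mat3
proof -
  have "\<forall>a b c. trip (M $ a) (M $ b) (M $ c) = levi a b c * det M"
    unfolding forall_3 levi_def by (simp add: cross_defs det_3 axis_def)
  then show ?thesis by blast
qed

lemma cross_cross_left: "cross (cross x y) z = cdot x z *s y - cdot y z *s x"
  by (simp add: cross_defs)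

lemma cross_cross_cross: "cross (cross p q) (cross r s) = trip r p q *s - s + trip s p q *s r"
  by (simp add: cross_defs)

text \<open>The Binet-Cauchy identity; it turns the minors in \<open>agree_at\<close> into cross
  products of coordinate vectors.\<close>

lemma minor_eq_cross: "cdot l x * cdot m y - cdot m x * cdot l y = cdot (cross l m) (cross x y)"
  by (simp add: cross_defs)

lemma cdot_cross_eq_0: "cdot x (cross x y) = 0" "cdot y (cross x y) = 0"
  by (simp_all add: cross_defs)

lemma cdot_simps:
  "cdot x (y + z) = cdot x y + cdot x z" "cdot (x + y) z = cdot x z + cdot y z"
  "cdot x (c *s y) = c * cdot x y" "cdot (c *s x) y = c * cdot x y"
  "cdot x 0 = 0" "cdot 0 x = 0"
  by (simp_all add: cdot_def algebra_simps)

text \<open>The adjugate times \<open>M\<close> is the scalar \<open>det M\<close>; the columns of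
  the adjugate are the cross products of pairs of rows.\<close>

lemma det_smult_eq_minors:
  "det M *s x = (M *v x)$1 *s cross (M$2) (M$3) + (M *v x)$2 *s cross (M$3) (M$1)
     + (M *v x)$3 *s cross (M$1) (M$2)" for M :: mat3
  by (simp add: mat_vec_component cross_defs det_3)

lemma cross_eq_0_imp_proportional:
  assumes "cross x y = 0" "x \<noteq> 0"
  obtains c where "y = c *s x"
proof -
  from assms(2) obtain i where i: "x $ i \<noteq> 0"
    by (metis vec_eq_iff zero_index)
  have "\<forall>i. x $ i \<noteq> 0 \<longrightarrow> y = (y $ i / x $ i) *s x"
    using assms(1) by (auto simp: cross_components vec_eq_iff forall_3 field_simps)
  with i that show thesis by blast
qed

text \<open>All rows are multiples of one nonzero row \<open>w\<close>, and the multipliers form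
  \<open>u\<close>. The zero matrix is included.\<close>

lemma rank_one_if_minors_vanish:
  fixes M :: mat3
  assumes "\<And>a b. cross (M $ a) (M $ b) = 0"
  obtains u w where "\<And>x. M *v x = cdot w x *s u"
proof (cases "M = 0")
  case True
  then show ?thesis using that[of 0 0] by (simp add: cdot_simps)
next
  case False
  then obtain a where a: "M $ a \<noteq> 0" by (metis vec_eq_iff zero_index)
  have "\<exists>c. M $ b = c *s M $ a" for b
    using cross_eq_0_imp_proportional[OF assms a] by metis
  then obtain c where c: "\<And>b. M $ b = c b *s M $ a" by metis
  have "M *v x = cdot (M $ a) x *s vec_lambda c" for x
    unfolding vec_eq_iff
    by (subst mat_vec_component, subst c) (simp add: cdot_simps)
  with that show ?thesis by blast
qed

lemma exists_orthogonal:
  obtains v where "v \<noteq> 0" "cdot x v = 0" "cdot y v = 0"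
proof (cases "cross x y = 0")
  case False
  then show ?thesis using that cdot_cross_eq_0 by blast
next
  case c: True
  have single: "\<exists>v. v \<noteq> 0 \<and> cdot x v = 0" for x
  proof (cases "x$1 = 0")
    case True
    then show ?thesis by (intro exI[of _ "axis 1 1"]) (simp add: cdot_def axis_def vec_eq_iff)
  next
    case False
    then show ?thesis
      by (intro exI[of _ "vector [x$2, - x$1, 0]"]) (auto simp: cdot_def vec_eq_iff forall_3)
  qed
  show ?thesis
  proof (cases "x = 0")
    case True
    then show ?thesis using single[of y] that by (auto simp: cdot_simps)
  next
    case False
    then obtain k where "y = k *s x" using c cross_eq_0_imp_proportional by metis
    then show ?thesis using single[of x] that by (auto simp: cdot_simps)
  qed
qed

lemma det_eq_0_imp_kernel:
  fixes M :: mat3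
  assumes "det M = 0"
  obtains x where "x \<noteq> 0" "M *v x = 0"
proof (cases "\<exists>a b. cross (M $ a) (M $ b) \<noteq> 0")
  case True
  then obtain a b where ab: "cross (M $ a) (M $ b) \<noteq> 0" by blast
  have "(M *v cross (M $ a) (M $ b)) $ c = 0" for c
    using trip_rows[of M c a b] assms by (simp add: mat_vec_component trip_def)
  then have "M *v cross (M $ a) (M $ b) = 0" by (simp add: vec_eq_iff)
  with ab that show ?thesis by blast
next
  case False
  then obtain u w where uw: "\<And>x. M *v x = cdot w x *s u"
    using rank_one_if_minors_vanish by metis
  obtain v where "v \<noteq> 0" "cdot w v = 0" using exists_orthogonal by metis
  with uw that show ?thesis by simp
qed

lemma orthogonal_pair_proportional:
  assumes "cdot x v = 0" "cdot y v = 0" "cross x y \<noteq> 0"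
  obtains c where "v = c *s cross x y"
proof -
  have "cross (cross x y) v = 0"
    using assms by (simp add: cross_cross_left)
  then show thesis using assms(3) that cross_eq_0_imp_proportional by blast
qed

lemma trip_eq_0_imp_in_span:
  assumes "trip x y z = 0" "cross x y \<noteq> 0"
  obtains a b where "z = a *s x + b *s y"
proof -
  have k: "cdot (cross x y) z = 0"
    using assms(1) by (simp add: trip_def cross_defs)
  obtain i where i: "cross x y $ i \<noteq> 0" using assms(2) by (metis vec_eq_iff zero_index)
  \<comment> \<open>Cramer's rule for \<open>axis i 1\<close> in terms of \<open>x\<close>,
    \<open>y\<close>, \<open>z\<close>; the last term vanishes by \<open>k\<close>.\<close>
  have "\<forall>i. cross x y $ i *s z = cross z y $ i *s x + cross x z $ i *s y
      + cdot (cross x y) z *s axis i 1"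
    by (simp add: cross_defs axis_def)
  then have "cross x y $ i *s z = cross z y $ i *s x + cross x z $ i *s y"
    using k by simp
  then have "z = (1 / cross x y $ i) *s (cross z y $ i *s x + cross x z $ i *s y)"
    using i by (metis nonzero_divide_eq_eq vector_smult_assoc vector_smult_lid)
  then show thesis using that by (simp add: vector_add_ldistrib vector_smult_assoc)
qed

section \<open>Homogeneous functions\<close>

lemma homogeneous_cmult: "homogeneous s d F \<Longrightarrow> homogeneous s d (\<lambda>x. c * F x)"
  using homogeneous.mult[OF homogeneous.const, of s d F c] by simp

lemma homogeneous_diff:
  "homogeneous s d F \<Longrightarrow> homogeneous s d G \<Longrightarrow> homogeneous s d (\<lambda>x. F x - G x)"
  using homogeneous.add[OF _ homogeneous_cmult[of s d G "-1"]] by simp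

lemma homogeneous_cross:
  assumes "\<And>i. homogeneous s d (\<lambda>x. p x $ i)" "\<And>i. homogeneous s e (\<lambda>x. q x $ i)"
  shows "homogeneous s (d + e) (\<lambda>x. cross (p x) (q x) $ i)"
proof -
  have "\<forall>i. homogeneous s (d + e) (\<lambda>x. cross (p x) (q x) $ i)"
    unfolding forall_3 cross_components
    by (intro conjI homogeneous_diff homogeneous.mult assms)
  then show ?thesis by blast
qed

lemma homogeneous_cdot:
  assumes "\<And>i. homogeneous s d (\<lambda>x. p x $ i)" "\<And>i. homogeneous s e (\<lambda>x. q x $ i)"
  shows "homogeneous s (d + e) (\<lambda>x. cdot (p x) (q x))"
  unfolding cdot_def by (intro homogeneous.add homogeneous.mult assms)

lemma homogeneous_det:
  fixes M :: "'a::ab_group_add \<Rightarrow> mat3"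
  assumes "\<And>i j. homogeneous s d (\<lambda>x. M x $ i $ j)"
  shows "homogeneous s (d + d + d) (\<lambda>x. det (M x))"
  unfolding det_3
  by (intro homogeneous.add homogeneous_diff homogeneous.mult assms)

lemma linear_functional_eq_cdot:
  fixes l :: "vec3 \<Rightarrow> complex"
  assumes "Vector_Spaces.linear (*s) (*) l"
  obtains L :: vec3 where "\<And>v. l v = cdot L v"
proof -
  interpret l: Vector_Spaces.linear "(*s)" "(*)" l by fact
  have "l v = cdot (\<chi> i. l (axis i 1)) v" for v :: vec3
  proof -
    have "v = v$1 *s axis 1 1 + v$2 *s axis 2 1 + v$3 *s axis 3 1"
      by (simp add: vec_eq_iff forall_3 axis_def)
    then have "l v = l (v$1 *s axis 1 1 + v$2 *s axis 2 1 + v$3 *s axis 3 1)" by simp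
    also have "\<dots> = cdot (\<chi> i. l (axis i 1)) v"
      by (simp add: l.add l.scale cdot_def mult.commute)
    finally show ?thesis .
  qed
  with that show thesis by blast
qed

lemma homogeneous_linear_comp:
  fixes l :: "vec3 \<Rightarrow> complex"
  assumes "Vector_Spaces.linear (*s) (*) l" "\<And>i. homogeneous s d (\<lambda>x. p x $ i)"
  shows "homogeneous s d (\<lambda>x. l (p x))"
proof -
  obtain L where "\<And>v. l v = cdot L v" using linear_functional_eq_cdot assms(1) by metis
  then show ?thesis
    unfolding cdot_def by (simp, intro homogeneous.add homogeneous_cmult assms(2))
qed

lemma linear_compose_functional:
  "Vector_Spaces.linear s1 s2 f \<Longrightarrow> Vector_Spaces.linear s2 s3 g \<Longrightarrow>
     Vector_Spaces.linear s1 s3 (\<lambda>x. g (f x))"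
  by (simp add: Vector_Spaces.linear_iff)

lemma zero_mod_atI:
  assumes "homogeneous s d S" "homogeneous s e K" "S x \<noteq> 0"
    and "\<And>y. y \<in> U \<Longrightarrow> S y * A y = F y * K y"
  shows "zero_mod_at s U F x A"
  unfolding zero_mod_at_def using assms by blast

lemma zero_mod_at_multiple:
  assumes "homogeneous s e K" "\<And>y. y \<in> U \<Longrightarrow> A y = F y * K y"
  shows "zero_mod_at s U F x A"
  by (rule zero_mod_atI[OF homogeneous.const[of s 1] assms(1)]) (simp_all add: assms(2))

section \<open>Determinantal cubics\<close>

text \<open>
  A tensor in \<open>U\<^sup>* \<otimes> U'\<^sup>* \<otimes> complex^3\<close> is read as a matrix \<open>M x\<close> of linear forms
  on \<open>U\<close> and as a matrix \<open>M' y\<close> on \<open>U'\<close>; both determinants cut out cubics, and the kernels of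
  the singular matrices, given by the columns of the adjugates, are mutually inverse maps.
  The map \<open>c\<close> takes coordinates on the source and \<open>r\<close> is its inverse; \<open>r'\<close> plays the role of
  \<open>r\<close> for the target.
\<close>

locale tensor =
  fixes s :: "complex \<Rightarrow> 'a::ab_group_add \<Rightarrow> 'a" and U :: "'a set" and M :: "'a \<Rightarrow> mat3"
    and c :: "'a \<Rightarrow> vec3" and r :: "vec3 \<Rightarrow> 'a"
    and t :: "complex \<Rightarrow> 'b::ab_group_add \<Rightarrow> 'b" and U' :: "'b set" and M' :: "'b \<Rightarrow> mat3"
    and r' :: "vec3 \<Rightarrow> 'b"
  assumes linear_M: "\<And>i j. Vector_Spaces.linear s (*) (\<lambda>x. M x $ i $ j)"
    and linear_M': "\<And>i j. Vector_Spaces.linear t (*) (\<lambda>x. M' x $ i $ j)"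
    and linear_c: "\<And>i. Vector_Spaces.linear s (*) (\<lambda>x. c x $ i)"
    and linear_r: "Vector_Spaces.linear (*s) s r"
    and linear_r': "Vector_Spaces.linear (*s) t r'"
    and r_c: "\<And>x. x \<in> U \<Longrightarrow> r (c x) = x"
    and r'_in: "\<And>v. r' v \<in> U'"
    and r'_inj: "\<And>v. r' v = 0 \<Longrightarrow> v = 0"
    and tensor_eq: "\<And>x v. x \<in> U \<Longrightarrow> M' (r' v) *v c x = M x *v v"
    and minor_nonzero: "\<And>x. x \<in> U \<Longrightarrow> x \<noteq> 0 \<Longrightarrow> \<exists>a b. cross (M x $ a) (M x $ b) \<noteq> 0"
begin

text \<open>Up to sign, the columns of the adjugate of \<open>M x\<close> (zero if
  \<open>a = b\<close>); they span the kernel when \<open>M x\<close> is singular of rank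
  two.\<close>

definition \<phi> :: "3 \<Rightarrow> 3 \<Rightarrow> 'a \<Rightarrow> 'b" where
  "\<phi> a b x = r' (cross (M x $ a) (M x $ b))"

definition maps :: "('a \<Rightarrow> 'b) set" where
  "maps = {\<phi> a b | a b. True}"

lemma c_nonzero: "x \<in> U \<Longrightarrow> x \<noteq> 0 \<Longrightarrow> c x \<noteq> 0"
  using r_c[of x] module_hom.zero[OF linear_r[unfolded linear_iff_module_hom]] by auto

lemma homogeneous_M: "homogeneous s 1 (\<lambda>x. M x $ i $ j)"
  by (rule homogeneous.linear[OF linear_M])

lemma homogeneous_minor: "homogeneous s 2 (\<lambda>x. cross (M x $ a) (M x $ b) $ i)"
  using homogeneous_cross[OF homogeneous_M homogeneous_M] by (simp add: numeral_2_eq_2)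

lemma homogeneous_\<phi>:
  "Vector_Spaces.linear t (*) l \<Longrightarrow> homogeneous s 2 (\<lambda>x. l (\<phi> a b x))"
  unfolding \<phi>_def
  by (rule homogeneous_linear_comp[OF linear_compose_functional[OF linear_r'] homogeneous_minor])

lemma homogeneous_M'_\<phi>: "homogeneous s 2 (\<lambda>x. M' (\<phi> a b x) $ i $ j)"
  by (rule homogeneous_\<phi>[OF linear_M'])

text \<open>By \<open>tensor_eq\<close>, this is \<open>M x\<close> applied to a column of its own
  adjugate. So \<open>c x\<close> is in the kernel of \<open>M' (\<phi> a b x)\<close> modulo the
  cubic.\<close>

lemma kernel_\<phi>: "x \<in> U \<Longrightarrow> (M' (\<phi> a b x) *v c x) $ i = levi i a b * det (M x)"
  unfolding \<phi>_def by (simp add: tensor_eq mat_vec_component trip_def flip: trip_rows)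

text \<open>Cramer's rule for \<open>M' (\<phi> a b y)\<close> and \<open>c y\<close>: the image of
  \<open>c y\<close> is divisible by \<open>det (M y)\<close>, hence so is the target determinant
  times each coordinate of \<open>c y\<close>. A coordinate that is nonzero at \<open>x\<close>
  serves as denominator.\<close>

lemma zero_mod_at_target:
  assumes x: "x \<in> U" "x \<noteq> 0"
  shows "zero_mod_at s U (\<lambda>x. det (M x)) x (\<lambda>y. det (M' (\<phi> a b y)))"
proof -
  obtain i where i: "c x $ i \<noteq> 0"
    using c_nonzero[OF x] by (metis vec_eq_iff zero_index)
  let ?m = "\<lambda>p q y. cross (M' (\<phi> a b y) $ p) (M' (\<phi> a b y) $ q) $ i"
  let ?K = "\<lambda>y. levi 1 a b * ?m 2 3 y + levi 2 a b * ?m 3 1 y + levi 3 a b * ?m 1 2 y"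
  have hK: "homogeneous s (2 + 2) ?K"
    by (intro homogeneous.add homogeneous_cmult homogeneous_cross homogeneous_M'_\<phi>)
  have hc: "homogeneous s 1 (\<lambda>y. c y $ i)"
    by (rule homogeneous.linear[OF linear_c])
  have "c y $ i * det (M' (\<phi> a b y)) = det (M y) * ?K y" if "y \<in> U" for y
    using arg_cong[OF det_smult_eq_minors[of "M' (\<phi> a b y)" "c y"], of "\<lambda>v. v $ i"]
    by (simp add: kernel_\<phi>[OF that] algebra_simps)
  then show ?thesis by (rule zero_mod_atI[OF hc hK i])
qed

text \<open>The cross product of two columns of the adjugate is \<open>det (M y)\<close> times a
  combination of rows of \<open>M y\<close>, so the minors are multiples of the cubic without any
  denominator.\<close>

lemma agree_at_maps: "agree_at s U (\<lambda>x. det (M x)) t x (\<phi> a b) (\<phi> p q)"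
proof -
  have "zero_mod_at s U (\<lambda>x. det (M x)) x
     (\<lambda>y. l (\<phi> a b y) * m (\<phi> p q y) - m (\<phi> a b y) * l (\<phi> p q y))"
    if lm: "Vector_Spaces.linear t (*) l" "Vector_Spaces.linear t (*) m" for l m
  proof -
    obtain l' where l': "\<And>v. l (r' v) = cdot l' v"
      using linear_functional_eq_cdot[OF linear_compose_functional[OF linear_r' lm(1)]] by metis
    obtain m' where m': "\<And>v. m (r' v) = cdot m' v"
      using linear_functional_eq_cdot[OF linear_compose_functional[OF linear_r' lm(2)]] by metis
    let ?K = "\<lambda>y. cdot (cross l' m') (levi q a b *s M y $ p) - cdot (cross l' m') (levi p a b *s M y $ q)"
    have "homogeneous s (0 + 1) ?K"
      by (intro homogeneous_diff homogeneous_cdot homogeneous.const)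
         (simp_all add: homogeneous_cmult homogeneous_M[simplified])
    moreover have "l (\<phi> a b y) * m (\<phi> p q y) - m (\<phi> a b y) * l (\<phi> p q y) = det (M y) * ?K y" for y
      unfolding \<phi>_def l' m' minor_eq_cross cross_cross_cross trip_rows
      by (simp add: cdot_def algebra_simps)
    ultimately show ?thesis by (rule zero_mod_at_multiple)
  qed
  then show ?thesis unfolding agree_at_def by blast
qed

lemma cubic_morphism_maps: "cubic_morphism s U (\<lambda>x. det (M x)) t U' (\<lambda>y. det (M' y)) maps"
  unfolding cubic_morphism_def
proof (intro conjI ballI impI)
  fix f assume "f \<in> maps"
  then obtain a b where f: "f = \<phi> a b" by (auto simp: maps_def)
  then show "f ` U \<subseteq> U'" by (auto simp: \<phi>_def r'_in)
  have "homogeneous_map s t 2 f" unfolding homogeneous_map_def f by (simp add: homogeneous_\<phi>)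
  then show "\<exists>d. homogeneous_map s t d f" ..
next
  fix x assume x: "x \<in> U - {0}" "det (M x) = 0"
  obtain a b where "cross (M x $ a) (M x $ b) \<noteq> 0" using minor_nonzero x by blast
  then have "\<phi> a b x \<noteq> 0" unfolding \<phi>_def using r'_inj by metis
  then show "\<exists>f\<in>maps. f x \<noteq> 0" unfolding maps_def by blast
  show "zero_mod_at s U (\<lambda>x. det (M x)) x (\<lambda>y. det (M' (f y)))" if "f \<in> maps" for f
    using that x zero_mod_at_target by (auto simp: maps_def)
  show "agree_at s U (\<lambda>x. det (M x)) t x f g" if "f \<in> maps" "g \<in> maps" for f g
    using that agree_at_maps by (auto simp: maps_def)
qed

text \<open>Both rows of \<open>M' (\<phi> a b y)\<close> are orthogonal to \<open>c y\<close>
  modulo \<open>det (M y)\<close>, so their cross product is parallel to \<open>c y\<close> modulo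
  the cubic.\<close>

lemma agree_at_inverse:
  "agree_at s U (\<lambda>x. det (M x)) s x
     (\<lambda>y. r (cross (M' (\<phi> a b y) $ p) (M' (\<phi> a b y) $ q))) (\<lambda>y. y)"
proof -
  have "zero_mod_at s U (\<lambda>x. det (M x)) x
     (\<lambda>y. l (r (cross (M' (\<phi> a b y) $ p) (M' (\<phi> a b y) $ q))) * m y
        - m (r (cross (M' (\<phi> a b y) $ p) (M' (\<phi> a b y) $ q))) * l y)"
    if lm: "Vector_Spaces.linear s (*) l" "Vector_Spaces.linear s (*) m" for l m
  proof -
    obtain l' where l': "\<And>v. l (r v) = cdot l' v"
      using linear_functional_eq_cdot[OF linear_compose_functional[OF linear_r lm(1)]] by metis
    obtain m' where m': "\<And>v. m (r v) = cdot m' v"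
      using linear_functional_eq_cdot[OF linear_compose_functional[OF linear_r lm(2)]] by metis
    let ?n = "\<lambda>p y. M' (\<phi> a b y) $ p"
    let ?K = "\<lambda>y. cdot (cross l' m') (levi p a b *s ?n q y) - cdot (cross l' m') (levi q a b *s ?n p y)"
    have "homogeneous s (0 + 2) ?K"
      by (intro homogeneous_diff homogeneous_cdot homogeneous.const)
         (simp_all add: homogeneous_cmult homogeneous_M'_\<phi>)
    moreover have "l (r (cross (?n p y) (?n q y))) * m y
        - m (r (cross (?n p y) (?n q y))) * l y = det (M y) * ?K y" if y: "y \<in> U" for y
    proof -
      have k: "cdot (?n i y) (c y) = levi i a b * det (M y)" for i
        using kernel_\<phi>[OF y] by (simp add: mat_vec_component)
      have ly: "l y = cdot l' (c y)" "m y = cdot m' (c y)"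
        using l'[of "c y"] m'[of "c y"] r_c[OF y] by simp_all
      show ?thesis
        unfolding ly l' m' minor_eq_cross cross_cross_left k
        by (simp add: cdot_def algebra_simps)
    qed
    ultimately show ?thesis by (rule zero_mod_at_multiple)
  qed
  then show ?thesis unfolding agree_at_def by blast
qed

end

section \<open>Hermitian forms of signature ++-\<close>

locale ppm_form =
  fixes H :: "vec3 \<Rightarrow> vec3 \<Rightarrow> complex"
  assumes hermitian: "hermitian_form H" and signature: "signature_ppm H"
begin

lemma H_cnj: "H y x = cnj (H x y)"
  by (rule hermitian[unfolded hermitian_form_def, THEN conjunct2, rule_format])

lemma H_left: "H (x + y) z = H x z + H y z" "H (c *s x) z = c * H x z" "H 0 z = 0"
proof -
  show a: "H (x + y) z = H x z + H y z" "H (c *s x) z = c * H x z" for c x y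
    using hermitian[unfolded hermitian_form_def, THEN conjunct1]
    by (simp_all add: Vector_Spaces.linear_iff)
  show "H 0 z = 0" using a(2)[of 0 0] by simp
qed

lemma H_right: "H x (y + z) = H x y + H x z" "H x (c *s y) = cnj c * H x y" "H x 0 = 0"
proof -
  show "H x (y + z) = H x y + H x z"
    unfolding H_cnj[of x "y + z"] H_cnj[of x y] H_cnj[of x z] by (simp add: H_left)
  show "H x (c *s y) = cnj c * H x y"
    unfolding H_cnj[of x "c *s y"] H_cnj[of x y] by (simp add: H_left)
  show "H x 0 = 0"
    unfolding H_cnj[of x 0] by (simp add: H_left)
qed

text \<open>Pairing a linear relation with each of the three vectors shows that its coefficients
  vanish, so the matrix \<open>P\<close> with these columns is invertible.\<close>

lemma orthonormal_basis:
  obtains e1 e2 e3 where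
    "H e1 e1 = 1" "H e2 e2 = 1" "H e3 e3 = -1"
    "H e1 e2 = 0" "H e1 e3 = 0" "H e2 e3 = 0" "H e2 e1 = 0" "H e3 e1 = 0" "H e3 e2 = 0"
    "\<forall>v. \<exists>x y z. v = x *s e1 + y *s e2 + z *s e3"
proof -
  obtain e1 e2 e3 where e: "H e1 e1 = 1" "H e2 e2 = 1" "H e3 e3 = -1"
    "H e1 e2 = 0" "H e1 e3 = 0" "H e2 e3 = 0"
    using signature unfolding signature_ppm_def by blast
  have e': "H e2 e1 = 0" "H e3 e1 = 0" "H e3 e2 = 0"
    using H_cnj[of e2 e1] H_cnj[of e3 e1] H_cnj[of e3 e2] e by simp_all
  define P :: mat3 where "P = (\<chi> i j. if j = 1 then e1$i else if j = 2 then e2$i else e3$i)"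
  have P: "P *v x = x$1 *s e1 + x$2 *s e2 + x$3 *s e3" for x
    by (simp add: vec_eq_iff mat_vec_component cdot_def P_def mult.commute)
  have "det P \<noteq> 0"
  proof
    assume "det P = 0"
    then obtain x where x: "x \<noteq> 0" "P *v x = 0" by (rule det_eq_0_imp_kernel)
    have "H (P *v x) e1 = x$1" "H (P *v x) e2 = x$2" "H (P *v x) e3 = - x$3"
      by (simp_all add: P H_left e e')
    then have "x $ 1 = 0" "x $ 2 = 0" "x $ 3 = 0" using x(2) by (simp_all add: H_left)
    with x show False by (simp add: vec_eq_iff forall_3)
  qed
  then obtain Q where "P ** Q = mat 1"
    unfolding invertible_det_nz[symmetric] invertible_def by blast
  then have "P *v (Q *v v) = v" for v
    by (simp add: matrix_vector_mul_assoc)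
  then have "\<exists>x y z. v = x *s e1 + y *s e2 + z *s e3" for v by (metis P)
  with that e e' show thesis by blast
qed

lemma nondegenerate:
  assumes "\<And>y. H x y = 0"
  shows "x = 0"
proof -
  obtain e1 e2 e3 where e: "H e1 e1 = 1" "H e2 e2 = 1" "H e3 e3 = -1"
    "H e1 e2 = 0" "H e1 e3 = 0" "H e2 e3 = 0" "H e2 e1 = 0" "H e3 e1 = 0" "H e3 e2 = 0"
    and b: "\<forall>v. \<exists>x y z. v = x *s e1 + y *s e2 + z *s e3"
    by (rule orthonormal_basis)
  obtain a b c where x: "x = a *s e1 + b *s e2 + c *s e3" using b by blast
  have "a = 0" "b = 0" "c = 0"
    using assms[of e1] assms[of e2] assms[of e3] by (simp_all add: x H_left e)
  then show ?thesis by (simp add: x)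
qed

text \<open>The orthogonal complement of a negative vector is positive definite; in orthonormal
  coordinates this is the Cauchy-Schwarz inequality for the two positive coordinates.\<close>

lemma isotropic_orthogonal_to_negative:
  assumes p: "Re (H p p) < 0" and u: "H u p = 0" "H u u = 0"
  shows "u = 0"
proof -
  obtain e1 e2 e3 where e: "H e1 e1 = 1" "H e2 e2 = 1" "H e3 e3 = -1"
    "H e1 e2 = 0" "H e1 e3 = 0" "H e2 e3 = 0" "H e2 e1 = 0" "H e3 e1 = 0" "H e3 e2 = 0"
    and basis: "\<forall>v. \<exists>x y z. v = x *s e1 + y *s e2 + z *s e3"
    by (rule orthonormal_basis)
  obtain a b c where uc: "u = a *s e1 + b *s e2 + c *s e3" using basis by blast
  obtain x y z where pc: "p = x *s e1 + y *s e2 + z *s e3" using basis by blast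
  have 1: "c * cnj z = a * cnj x + b * cnj y"
    using u(1) by (simp add: uc pc H_left H_right e algebra_simps)
  have 2: "(cmod c)\<^sup>2 = (cmod a)\<^sup>2 + (cmod b)\<^sup>2"
  proof -
    have "a * cnj a + b * cnj b = c * cnj c"
      using u(2) by (simp add: uc H_left H_right e algebra_simps)
    then have "complex_of_real ((cmod a)\<^sup>2 + (cmod b)\<^sup>2) = complex_of_real ((cmod c)\<^sup>2)"
      by (simp only: of_real_add complex_norm_square)
    then show ?thesis by (simp only: of_real_eq_iff)
  qed
  have 3: "(cmod x)\<^sup>2 + (cmod y)\<^sup>2 < (cmod z)\<^sup>2"
  proof -
    have "H p p = x * cnj x + y * cnj y - z * cnj z"
      by (simp add: pc H_left H_right e algebra_simps)
    also have "\<dots> = complex_of_real ((cmod x)\<^sup>2 + (cmod y)\<^sup>2 - (cmod z)\<^sup>2)"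
      by (simp only: of_real_add of_real_diff complex_norm_square)
    finally show ?thesis using p by simp
  qed
  have "cmod c * cmod z \<le> cmod a * cmod x + cmod b * cmod y"
    by (metis 1 complex_mod_cnj norm_mult norm_triangle_ineq)
  then have "(cmod c * cmod z)\<^sup>2 \<le> (cmod a * cmod x + cmod b * cmod y)\<^sup>2"
    by (rule power_mono) simp
  \<comment> \<open>Lagrange's identity: the two sides differ by the square of
    \<open>cmod a * cmod y - cmod b * cmod x\<close>.\<close>
  also have "\<dots> \<le> ((cmod a)\<^sup>2 + (cmod b)\<^sup>2) * ((cmod x)\<^sup>2 + (cmod y)\<^sup>2)"
    using zero_le_power2[of "cmod a * cmod y - cmod b * cmod x"]
    by (simp add: power2_eq_square algebra_simps)
  finally have "(cmod c)\<^sup>2 * (cmod z)\<^sup>2 \<le> (cmod c)\<^sup>2 * ((cmod x)\<^sup>2 + (cmod y)\<^sup>2)"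
    by (simp add: 2 power_mult_distrib)
  with 3 have "(cmod c)\<^sup>2 = 0"
    by (metis mult_le_cancel_left_pos not_less zero_less_power2 zero_eq_power2)
  with 2 have "a = 0 \<and> b = 0 \<and> c = 0"
    by (simp add: add_nonneg_eq_0_iff)
  then show ?thesis by (simp add: uc)
qed

text \<open>With the Gram matrix \<open>J\<close> and the conjugate transpose \<open>k\<close> of
  \<open>h\<close>, self-adjointness reads \<open>J ** h = k ** J\<close>. Taking determinants,
  \<open>det J\<close> cancels.\<close>

lemma det_self_adjoint_real:
  assumes "adjoint_wrt H h h"
  shows "det h \<in> \<real>"
proof -
  define J :: mat3 where "J = (\<chi> i j. H (axis j 1) (axis i 1))"
  define k :: mat3 where "k = (\<chi> i j. cnj (h $ j $ i))"
  have decomp: "x = x$1 *s axis 1 1 + x$2 *s axis 2 1 + x$3 *s axis 3 1" for x :: vec3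
    by (simp add: vec_eq_iff forall_3 axis_def)
  have J: "H x (axis i 1) = (J *v x) $ i" for x i
    by (subst decomp[of x]) (simp add: H_left mat_vec_component cdot_def J_def mult.commute)
  have h_axis: "(h *v axis i 1) $ l = h $ l $ i" for i l
    by (simp add: matrix_vector_mult_def axis_def if_distrib cong: if_cong)
  have k: "(k *v w) $ i = cnj (h$1$i) * w$1 + cnj (h$2$i) * w$2 + cnj (h$3$i) * w$3" for w i
    by (simp add: mat_vec_component cdot_def k_def)
  have "det J \<noteq> 0"
  proof
    assume "det J = 0"
    then obtain x where x: "x \<noteq> 0" "J *v x = 0" by (rule det_eq_0_imp_kernel)
    have "H x y = 0" for y
      by (subst decomp[of y]) (simp add: H_right J x)
    with x nondegenerate show False by blast
  qed
  moreover have "J ** h = k ** J"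
  proof -
    have "(J *v (h *v x)) $ i = (k *v (J *v x)) $ i" for x i
    proof -
      have "(J *v (h *v x)) $ i = H x (h *v axis i 1)"
        using assms by (simp add: adjoint_wrt_def flip: J)
      also have "\<dots> = (k *v (J *v x)) $ i"
        by (subst decomp[of "h *v axis i 1"])
           (simp only: H_right J k h_axis)
      finally show ?thesis .
    qed
    then show ?thesis
      by (simp add: matrix_eq vec_eq_iff flip: matrix_vector_mul_assoc)
  qed
  then have "det J * det h = det k * det J" by (metis det_mul)
  moreover have "det k = cnj (det h)" by (simp add: det_3 k_def algebra_simps)
  ultimately have "det h = cnj (det h)" by simp
  then show ?thesis by (simp add: Reals_cnj_iff)
qed

end

section \<open>Generic elliptic families\<close>

lemma cscale_component [simp]: "cscale c A $ i $ j = c * A $ i $ j"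
  by (simp add: cscale_def)

interpretation cscale: vector_space cscale
  by unfold_locales (simp_all add: vec_eq_iff algebra_simps)

lemma cscale_of_real: "cscale (complex_of_real r) A = r *\<^sub>R A"
  by (simp add: vec_eq_iff scaleR_conv_of_real[where 'a=complex])

lemma cscale_mult_vec: "cscale c A *v x = c *s (A *v x)"
  by (simp add: vec_eq_iff mat_vec_component cdot_def algebra_simps)

lemma scaleR_mult_vec: "(r *\<^sub>R A) *v x = complex_of_real r *s (A *v x)" for A :: mat3
  by (simp add: cscale_mult_vec flip: cscale_of_real)

lemma det_eq_0_if_kernel:
  fixes M :: mat3
  assumes "M *v x = 0" "x \<noteq> 0"
  shows "det M = 0"
proof -
  have "det M *s x = 0" by (subst det_smult_eq_minors) (simp add: assms(1))
  with assms(2) show ?thesis by (simp add: vec.scale_eq_0_iff)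
qed

lemma dim_span_pair:
  fixes A B :: "'a::real_vector"
  assumes "\<And>r s. r *\<^sub>R A + s *\<^sub>R B = 0 \<Longrightarrow> r = 0 \<and> s = 0"
  shows "dim (span {A, B}) = 2"
proof -
  have "B \<noteq> 0" using assms[of 0 1] by auto
  moreover have "A \<notin> span {B}"
  proof
    assume "A \<in> span {B}"
    then obtain k where "A = k *\<^sub>R B" by (auto simp: span_singleton)
    then show False using assms[of 1 "-k"] by simp
  qed
  ultimately have "independent {A, B}" "card {A, B} = 2"
    by (auto simp: independent_insert span_base card_insert_if)
  then show ?thesis by (metis real_vector.dim_span_eq_card_independent)
qed

section \<open>Kernels and ranks in the family and its complexification\<close>

locale generic_family = ppm_form +
  fixes W :: "mat3 set"
  assumes generic: "generic_elliptic_family H W"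
begin

lemma H_minus: "H (- x) y = - H x y" "H x (- y) = - H x y"
  using H_left(2)[of "-1" x y] H_right(2)[of x "-1" y] by simp_all

lemma H_diff: "H x (y - z) = H x y - H x z"
  using H_right(1)[of x y "- z"] by (simp add: H_minus)

lemma elliptic: "elliptic_family H W"
  using generic by (simp add: generic_elliptic_family_def)

lemma bisector: "bisector_family H W"
  using elliptic by (simp add: elliptic_family_def)

lemma W_subspace: "subspace W"
  using bisector by (simp add: bisector_family_def)

lemma W_trace: "h \<in> W \<Longrightarrow> trace h = 0"
  using bisector by (simp add: bisector_family_def)

lemma W_self_adjoint: "h \<in> W \<Longrightarrow> adjoint_wrt H h h"
  using bisector by (simp add: bisector_family_def)

lemma W_det_real: "h \<in> W \<Longrightarrow> det h \<in> \<real>"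
  by (rule det_self_adjoint_real[OF W_self_adjoint])

lemma W_adjoint: "h \<in> W \<Longrightarrow> H (h *v x) y = H x (h *v y)"
  using W_self_adjoint by (simp add: adjoint_wrt_def)

text \<open>On the complexification, the adjoint is the complex conjugation that fixes
  \<open>W\<close>.\<close>

lemma star: "A \<in> W \<Longrightarrow> B \<in> W \<Longrightarrow>
    H ((A + cscale \<i> B) *v x) y = H x ((A + cscale (-\<i>) B) *v y)"
  by (simp add: matrix_vector_mult_add_rdistrib cscale_mult_vec H_left H_right H_minus H_diff W_adjoint
      matrix_vector_mult_diff_rdistrib)

text \<open>Being \<open>-\<i>\<close> times the self-adjoint \<open>B\<close>, the self-adjoint
  \<open>A\<close> is also skew-adjoint.\<close>

lemma totally_real:
  assumes "A \<in> W" "B \<in> W" "A + cscale \<i> B = 0"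
  shows "A = 0" "B = 0"
proof -
  have m: "A *v x = - \<i> *s (B *v x)" for x
    using arg_cong[OF assms(3), of "\<lambda>M. M *v x"]
    by (simp add: matrix_vector_mult_add_rdistrib cscale_mult_vec eq_neg_iff_add_eq_0)
  have "H (B *v x) y = 0" for x y
    using W_adjoint[OF assms(1), of x y] by (simp add: m H_left H_right H_minus W_adjoint[OF assms(2)])
  then have "B *v x = 0" for x using nondegenerate by blast
  then show "B = 0" by (simp add: matrix_eq)
  with assms(3) show "A = 0" by simp
qed

text \<open>If \<open>A\<close> and \<open>B\<close> were independent, their real span would be a
  confocal line with focus \<open>v\<close>.\<close>

lemma no_confocal_pair:
  assumes AB: "A \<in> W" "B \<in> W" and v: "v \<noteq> 0" "A *v v = 0" "B *v v = 0"
  obtains r s where "r *\<^sub>R A + s *\<^sub>R B = 0" "r \<noteq> 0 \<or> s \<noteq> 0"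
proof -
  have "\<exists>r s. r *\<^sub>R A + s *\<^sub>R B = 0 \<and> (r \<noteq> 0 \<or> s \<noteq> 0)"
  proof (rule ccontr)
    assume "\<not> ?thesis"
    then have "dim (span {A, B}) = 2" by (intro dim_span_pair) blast
    moreover have sub: "span {A, B} \<subseteq> W"
      using AB W_subspace by (intro span_minimal) auto
    moreover have kernel: "\<forall>h\<in>span {A, B}. h *v v = 0"
    proof -
      have "subspace {h :: mat3. h *v v = 0}"
        by (auto simp: subspace_def matrix_vector_mult_add_rdistrib cscale_mult_vec
            simp flip: cscale_of_real)
      then have "span {A, B} \<subseteq> {h :: mat3. h *v v = 0}"
        using v by (intro span_minimal) auto
      then show ?thesis by blast
    qed
    moreover have "proj scaleR (span {A, B}) \<subseteq> real_cubic W"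
      using sub kernel v(1) det_eq_0_if_kernel
      unfolding real_cubic_def proj_zeros_def proj_def by (intro image_mono) blast
    ultimately have "confocal_line W (span {A, B})"
      using v(1) unfolding confocal_line_def by auto
    with generic show False by (simp add: generic_elliptic_family_def)
  qed
  with that show thesis by blast
qed

text \<open>The vanishing trace makes the image vector \<open>u\<close> isotropic, and the negative
  point \<open>p\<close> of the family is orthogonal to it; this forces
  \<open>u = 0\<close>.\<close>

lemma W_no_rank_one:
  assumes R: "R \<in> W" and Rx: "\<And>x. R *v x = cdot w x *s u"
  shows "R = 0"
proof (rule ccontr)
  assume "R \<noteq> 0"
  then obtain x where x: "R *v x \<noteq> 0" by (metis matrix_eq matrix_vector_mult_0)
  then have wx: "cdot w x \<noteq> 0" and u: "u \<noteq> 0" using Rx by auto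
  obtain p where p: "Re (H p p) < 0" "H (R *v p) p = 0"
    using bisector R unfolding bisector_family_def by blast
  have "trace R = cdot w u"
  proof -
    have "R $ i $ i = cdot w (axis i 1) * u $ i" for i
    proof -
      have "(R *v axis i 1) $ i = R $ i $ i"
        by (simp add: matrix_vector_mult_def axis_def if_distrib cong: if_cong)
      then show ?thesis by (simp add: Rx)
    qed
    then show ?thesis by (simp add: trace_def sum_3 cdot_def axis_def)
  qed
  then have "R *v u = 0" using W_trace[OF R] by (simp add: Rx)
  then have "H u u = 0"
    using W_adjoint[OF R, of x u] wx by (simp add: Rx[of x] H_left H_right)
  \<comment> \<open>If \<open>R\<close> kills \<open>p\<close>, self-adjointness moves
    \<open>R\<close> from \<open>x\<close> to \<open>p\<close>. Otherwise
    \<open>H (R *v p) p = 0\<close> is a nonzero multiple of the claim.\<close>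
  moreover have "H u p = 0"
  proof (cases "cdot w p = 0")
    case True
    then show ?thesis
      using W_adjoint[OF R, of x p] wx by (simp add: Rx H_left H_right)
  next
    case False
    then show ?thesis using p(2) by (simp add: Rx H_left)
  qed
  ultimately show False using isotropic_orthogonal_to_negative p(1) u by blast
qed

text \<open>
  An element of rank one and its adjoint have a common kernel, so they span either a
  confocal line or a multiple of an element of \<open>W\<close>.
\<close>

lemma no_rank_one:
  assumes h: "h \<in> complexification W" and hx: "\<And>x. h *v x = cdot w x *s u"
  shows "h = 0"
proof -
  obtain A B where AB: "A \<in> W" "B \<in> W" and hAB: "h = A + cscale \<i> B"
    using h unfolding complexification_def by blast
  have "Vector_Spaces.linear (*s) (*) (\<lambda>x. H x u)"
    using hermitian unfolding hermitian_form_def by (rule conjunct1[THEN spec])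
  then obtain L where L: "\<And>x. H x u = cdot L x" using linear_functional_eq_cdot by metis
  \<comment> \<open>This \<open>v\<close> is in the kernel of \<open>h\<close> and orthogonal to its
    image, so the adjoint of \<open>h\<close> kills it too.\<close>
  obtain v where v: "v \<noteq> 0" "cdot w v = 0" "cdot L v = 0" using exists_orthogonal by metis
  have uv: "H u v = 0" using L v(3) H_cnj[of u v] by simp
  have 1: "(A + cscale \<i> B) *v v = 0" using hx[of v] v(2) by (simp add: hAB)
  have "H ((A + cscale (-\<i>) B) *v v) x = 0" for x
  proof -
    have "H x ((A + cscale (-\<i>) B) *v v) = H (h *v x) v"
      using star[OF AB] by (simp add: hAB)
    also have "\<dots> = 0" by (simp add: hx H_left uv)
    finally show ?thesis by (subst H_cnj) simp
  qed
  then have "(A + cscale (-\<i>) B) *v v = 0" using nondegenerate by blast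
  with 1 have sum: "A *v v + \<i> *s (B *v v) = 0" and diff: "A *v v - \<i> *s (B *v v) = 0"
    by (simp_all add: matrix_vector_mult_add_rdistrib matrix_vector_mult_diff_rdistrib cscale_mult_vec)
  have "A *v v + A *v v = 0"
    using arg_cong2[OF sum diff, of "(+)"] by simp
  then have "A *v v = 0" by (simp add: vec_eq_iff flip: mult_2)
  moreover from this sum have "B *v v = 0" by (simp add: vec.scale_eq_0_iff)
  ultimately obtain r s where rs: "r *\<^sub>R A + s *\<^sub>R B = 0" "r \<noteq> 0 \<or> s \<noteq> 0"
    using no_confocal_pair AB v(1) by metis
  \<comment> \<open>A real relation between \<open>A\<close> and \<open>B\<close> makes
    \<open>h\<close> a complex multiple of one element of \<open>W\<close>.\<close>
  have "\<exists>R\<in>W. \<exists>c. c \<noteq> 0 \<and> h = cscale c R"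
  proof (cases "s = 0")
    case True
    then have "A = 0" using rs by simp
    then show ?thesis using AB hAB by (intro bexI[of _ B] exI[of _ \<i>]) auto
  next
    case False
    have "s *\<^sub>R B = - (r *\<^sub>R A)" using rs(1) by (simp add: add_eq_0_iff)
    then have "(1 / s) *\<^sub>R (s *\<^sub>R B) = (1 / s) *\<^sub>R - (r *\<^sub>R A)" by simp
    with False have B: "B = (- r / s) *\<^sub>R A" by simp
    have "1 + \<i> * complex_of_real (- r / s) \<noteq> 0"
      by (simp add: complex_eq_iff)
    moreover have "h = cscale (1 + \<i> * complex_of_real (- r / s)) A"
      unfolding hAB B by (simp add: vec_eq_iff scaleR_conv_of_real[where 'a=complex] algebra_simps)
    ultimately show ?thesis using AB by blast
  qed
  then obtain R c where R: "R \<in> W" "c \<noteq> 0" "h = cscale c R" by blast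
  have "R *v x = cdot w x *s ((1/c) *s u)" for x
  proof -
    have "c *s (R *v x) = cdot w x *s u" using hx[of x] R(3) by (simp add: cscale_mult_vec)
    then have "(1/c) *s (c *s (R *v x)) = (1/c) *s (cdot w x *s u)" by simp
    with R(2) show ?thesis by (simp add: mult.commute)
  qed
  then have "R = 0" using W_no_rank_one R(1) by blast
  with R(3) show ?thesis by simp
qed

end

section \<open>Polynomial identities for determinants of linear systems\<close>

lemma trip_linear:
  "trip (x + x') y z = trip x y z + trip x' y z"
  "trip x (y + y') z = trip x y z + trip x y' z"
  "trip x y (z + z') = trip x y z + trip x y z'"
  "trip (c *s x) y z = c * trip x y z"
  "trip x (c *s y) z = c * trip x y z"
  "trip x y (c *s z) = c * trip x y z"
  by (simp_all add: cross_defs)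

lemma det_eq_trip: "det M = trip (M$1) (M$2) (M$3)" for M :: mat3
  by (simp add: cross_defs det_3)

lemma det_pencil_expansion:
  fixes A B C :: mat3
  obtains c300 c210 c201 c120 c111 c102 c030 c021 c012 c003 where
    "\<forall>x y z. det (cscale x A + cscale y B + cscale z C) =
       c300 * x^3 + c210 * (x^2 * y) + c201 * (x^2 * z) + c120 * (x * y^2) + c111 * (x * y * z)
       + c102 * (x * z^2) + c030 * y^3 + c021 * (y^2 * z) + c012 * (y * z^2) + c003 * z^3"
proof -
  \<comment> \<open>The mixed determinant, with one row from each matrix. The coefficients collect
    its values by multilinearity in the rows.\<close>
  define m where "m P Q R = trip (P$1) (Q$2) (R$3)" for P Q R :: mat3
  have row: "cscale x A $ i = x *s A $ i" for x i and A :: mat3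
    by (simp add: vec_eq_iff)
  show thesis
  proof (rule that, intro allI)
    show "det (cscale x A + cscale y B + cscale z C) =
      m A A A * x^3 + (m A A B + m A B A + m B A A) * (x^2 * y) + (m A A C + m A C A + m C A A) * (x^2 * z)
      + (m A B B + m B A B + m B B A) * (x * y^2)
      + (m A B C + m A C B + m B A C + m B C A + m C A B + m C B A) * (x * y * z)
      + (m A C C + m C A C + m C C A) * (x * z^2) + m B B B * y^3
      + (m B B C + m B C B + m C B B) * (y^2 * z) + (m B C C + m C B C + m C C B) * (y * z^2)
      + m C C C * z^3" for x y z
      unfolding det_eq_trip m_def
      by (simp add: trip_linear row) (simp add: algebra_simps power2_eq_square power3_eq_cube)
  qed
qed

lemma binary_cubic_eq_0:
  fixes p q r s :: complex
  assumes "\<And>x y. p * of_real (x^3) + q * of_real (x^2 * y) + r * of_real (x * y^2) + s * of_real (y^3) = 0"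
  shows "p = 0" "q = 0" "r = 0" "s = 0"
proof -
  show p: "p = 0" using assms[of 1 0] by simp
  show s: "s = 0" using assms[of 0 1] by simp
  have 1: "q + r = 0" using assms[of 1 1] by (simp add: p s)
  have 2: "q - r = 0" using assms[of "-1" 1] by (simp add: p s)
  have "q + q = 0" using arg_cong2[OF 1 2, of "(+)"] by simp
  then show "q = 0" by (simp flip: mult_2)
  with 1 show "r = 0" by simp
qed

lemma conjugate_pair_eq_0:
  fixes p q :: complex
  assumes "\<i> * p + q = 0" "- (\<i> * p) + q = 0"
  shows "p = 0" "q = 0"
proof -
  have "q + q = 0" using arg_cong2[OF assms, of "(+)"] by simp
  then show "q = 0" by (simp flip: mult_2)
  with assms(1) show "p = 0" by simp
qed

lemma in_span_pair: "h \<in> span {P, Q} \<longleftrightarrow> (\<exists>r s. h = r *\<^sub>R P + s *\<^sub>R Q)"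
  for P Q :: "'a::real_vector"
proof
  assume "h \<in> span {P, Q}"
  then obtain r s where "h - r *\<^sub>R P = s *\<^sub>R Q"
    by (auto simp: span_breakdown_eq span_singleton)
  then have "h = r *\<^sub>R P + s *\<^sub>R Q" by (simp add: algebra_simps)
  then show "\<exists>r s. h = r *\<^sub>R P + s *\<^sub>R Q" by blast
qed (auto intro: span_add span_scale span_base)

section \<open>Images of a single vector under the family\<close>

context generic_family
begin

lemma W_dim: "dim W = 3"
  using elliptic by (simp add: elliptic_family_def)

lemma W_det_nonzero: obtains h where "h \<in> W" "det h \<noteq> 0"
  using elliptic by (auto simp: elliptic_family_def degenerate_part_def)

lemma not_in_span_pair: "\<not> W \<subseteq> span {P, Q}"
proof
  assume "W \<subseteq> span {P, Q}"
  then have "dim W \<le> card {P, Q}" by (rule dim_le_card) simp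
  also have "\<dots> \<le> 2" by (simp add: card_insert_if)
  finally show False by (simp add: W_dim)
qed

text \<open>As there is no confocal line, the elements killing \<open>v\<close> form a space of
  dimension at most one; \<open>k\<close> may be zero.\<close>

lemma W_kernel_line:
  assumes "v \<noteq> 0"
  obtains k where "k \<in> W" "k *v v = 0" "\<And>h. h \<in> W \<Longrightarrow> h *v v = 0 \<Longrightarrow> \<exists>r. h = r *\<^sub>R k"
proof (cases "\<exists>k\<in>W. k \<noteq> 0 \<and> k *v v = 0")
  case False
  show ?thesis
    by (rule that[of 0]) (use False W_subspace subspace_0 in auto)
next
  case True
  then obtain k where k: "k \<in> W" "k \<noteq> 0" "k *v v = 0" by blast
  show ?thesis
  proof (rule that[OF k(1,3)])
    fix h assume "h \<in> W" "h *v v = 0"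
    then obtain r s where rs: "r *\<^sub>R k + s *\<^sub>R h = 0" "r \<noteq> 0 \<or> s \<noteq> 0"
      using no_confocal_pair[OF k(1) _ assms k(3)] by metis
    with k(2) have "s \<noteq> 0" by auto
    have "s *\<^sub>R h = - (r *\<^sub>R k)" using rs(1) by (simp add: add_eq_0_iff)
    then have "(1 / s) *\<^sub>R (s *\<^sub>R h) = (1 / s) *\<^sub>R - (r *\<^sub>R k)" by simp
    with \<open>s \<noteq> 0\<close> have "h = (- r / s) *\<^sub>R k" by simp
    then show "\<exists>r. h = r *\<^sub>R k" by blast
  qed
qed

lemma singular_if_image_orthogonal:
  assumes "v \<noteq> 0" "\<And>x. H (T *v x) v = 0"
  shows "det T = 0"
proof (rule ccontr)
  assume "det T \<noteq> 0"
  then obtain Q where "T ** Q = mat 1"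
    unfolding invertible_det_nz[symmetric] invertible_def by blast
  then have "T *v (Q *v x) = x" for x by (simp add: matrix_vector_mul_assoc)
  then have "H x v = 0" for x using assms(2) by metis
  then have "H v x = 0" for x by (subst H_cnj) simp
  with assms(1) nondegenerate show False by blast
qed

lemma W_comb: "h \<in> W \<Longrightarrow> k \<in> W \<Longrightarrow> r *\<^sub>R h + s *\<^sub>R k \<in> W"
  using W_subspace by (simp add: subspace_add subspace_scale)

text \<open>
  A point \<open>v\<close> that all of \<open>W\<close> maps into one line would be the common kernel of a complex pencil
  \<open>h0, b - \<i> a\<close>, so that the cubic contains two complex conjugate lines through \<open>h0\<close>.
\<close>

lemma conjugate_pencils:
  assumes v: "v \<noteq> 0" and img: "\<And>h. h \<in> W \<Longrightarrow> \<exists>z. h *v v = z *s u"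
  obtains h0 a b where "h0 \<in> W" "a \<in> W" "b \<in> W" "h0 \<noteq> 0" "h0 *v v = 0" "a *v v \<noteq> 0"
    "b *v v = \<i> *s (a *v v)"
    "\<And>h. h \<in> W \<Longrightarrow> \<exists>x s t. h = x *\<^sub>R h0 + s *\<^sub>R a + t *\<^sub>R b"
proof -
  obtain k where k: "k \<in> W" "k *v v = 0" "\<And>h. h \<in> W \<Longrightarrow> h *v v = 0 \<Longrightarrow> \<exists>r. h = r *\<^sub>R k"
    using W_kernel_line v by blast
  have "\<exists>a\<in>W. a *v v \<noteq> 0"
  proof (rule ccontr)
    assume "\<not> ?thesis"
    then have "W \<subseteq> span {k, k}" using k(3) by (fastforce simp: span_singleton)
    with not_in_span_pair show False by blast
  qed
  then obtain a where a: "a \<in> W" "a *v v \<noteq> 0" by blast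
  have img': "\<exists>z. h *v v = z *s (a *v v)" if h: "h \<in> W" for h
  proof -
    obtain z y where zy: "h *v v = z *s u" "a *v v = y *s u" using img[OF h] img[OF a(1)] by blast
    with a(2) have "y \<noteq> 0" by auto
    then have "h *v v = (z / y) *s (a *v v)" by (simp add: zy)
    then show ?thesis by blast
  qed
  \<comment> \<open>Otherwise \<open>W\<close> maps \<open>v\<close> to real multiples of
    \<open>a *v v\<close> only, and is spanned by \<open>a\<close> and \<open>k\<close>.\<close>
  have "\<exists>b\<in>W. \<exists>z. b *v v = z *s (a *v v) \<and> Im z \<noteq> 0"
  proof (rule ccontr)
    assume no: "\<not> ?thesis"
    have "h \<in> span {a, k}" if h: "h \<in> W" for h
    proof -
      obtain z where z: "h *v v = z *s (a *v v)" using img' h by blast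
      with no h have "Im z = 0" by blast
      then have zr: "z = complex_of_real (Re z)" by (simp add: complex_eq_iff)
      have "(h - Re z *\<^sub>R a) *v v = 0"
        by (simp add: matrix_vector_mult_diff_rdistrib z cscale_mult_vec flip: cscale_of_real zr)
      moreover have "h - Re z *\<^sub>R a \<in> W"
        using W_subspace h a(1) by (simp add: subspace_diff subspace_scale)
      ultimately obtain r where "h - Re z *\<^sub>R a = r *\<^sub>R k" using k(3) by blast
      then have "h = Re z *\<^sub>R a + r *\<^sub>R k" by (simp add: algebra_simps)
      then show ?thesis unfolding in_span_pair by blast
    qed
    with not_in_span_pair show False by blast
  qed
  then obtain b0 z where b0: "b0 \<in> W" "b0 *v v = z *s (a *v v)" "Im z \<noteq> 0" by blast
  \<comment> \<open>A real combination of \<open>b0\<close> and \<open>a\<close> normalises the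
    non-real factor \<open>z\<close> to \<open>\<i>\<close>.\<close>
  define b where "b = (1 / Im z) *\<^sub>R b0 + (- Re z / Im z) *\<^sub>R a"
  have b: "b \<in> W" unfolding b_def using b0(1) a(1) by (rule W_comb)
  have "b *v v = (complex_of_real (1 / Im z) * z + complex_of_real (- Re z / Im z)) *s (a *v v)"
    unfolding b_def
    by (simp only: matrix_vector_mult_add_rdistrib scaleR_mult_vec b0(2) vector_sadd_rdistrib
        vector_smult_assoc)
  also have "complex_of_real (1 / Im z) * z + complex_of_real (- Re z / Im z) = \<i>"
    using b0(3) by (simp add: complex_eq_iff)
  finally have bv: "b *v v = \<i> *s (a *v v)" .
  have decomp: "\<exists>x s t. h = x *\<^sub>R k + s *\<^sub>R a + t *\<^sub>R b" if h: "h \<in> W" for h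
  proof -
    obtain z where z: "h *v v = z *s (a *v v)" using img' h by blast
    have "(h - (Re z *\<^sub>R a + Im z *\<^sub>R b)) *v v
        = z *s (a *v v) - (complex_of_real (Re z) + complex_of_real (Im z) * \<i>) *s (a *v v)"
      by (simp only: matrix_vector_mult_diff_rdistrib matrix_vector_mult_add_rdistrib z bv
          scaleR_mult_vec vector_sadd_rdistrib vector_smult_assoc)
    also have "complex_of_real (Re z) + complex_of_real (Im z) * \<i> = z" by (simp add: complex_eq_iff)
    also have "z *s (a *v v) - z *s (a *v v) = 0" by simp
    finally have "(h - (Re z *\<^sub>R a + Im z *\<^sub>R b)) *v v = 0" .
    moreover have "h - (Re z *\<^sub>R a + Im z *\<^sub>R b) \<in> W"
      using W_subspace h W_comb[OF a(1) b] by (simp add: subspace_diff)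
    ultimately obtain r where "h - (Re z *\<^sub>R a + Im z *\<^sub>R b) = r *\<^sub>R k" using k(3) by blast
    then have "h = r *\<^sub>R k + Re z *\<^sub>R a + Im z *\<^sub>R b" by (simp add: algebra_simps)
    then show ?thesis by blast
  qed
  have "k \<noteq> 0"
  proof
    assume "k = 0"
    then have "W \<subseteq> span {a, b}" using decomp by (fastforce simp: in_span_pair)
    with not_in_span_pair show False by blast
  qed
  with that k(1,2) a b bv decomp show thesis by blast
qed

text \<open>
  The pencil \<open>h0, b + \<i> a\<close> is adjoint to \<open>h0, b - \<i> a\<close>, so both are singular, and the
  determinant vanishes at the complex points with \<open>s\<^sup>2 + t\<^sup>2 = 0\<close>.
\<close>

lemma det_factorization:
  assumes W: "h0 \<in> W" "a \<in> W" "b \<in> W"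
    and v: "v \<noteq> 0" "h0 *v v = 0" "b *v v = \<i> *s (a *v v)"
  obtains \<alpha> \<beta> \<gamma> :: real where
    "\<And>x s t. det (x *\<^sub>R h0 + s *\<^sub>R a + t *\<^sub>R b) = of_real ((s\<^sup>2 + t\<^sup>2) * (\<alpha> * x + \<beta> * s + \<gamma> * t))"
proof -
  obtain c300 c210 c201 c120 c111 c102 c030 c021 c012 c003 where
    c: "\<forall>x y z. det (cscale x h0 + cscale y a + cscale z b) =
       c300 * x^3 + c210 * (x^2 * y) + c201 * (x^2 * z) + c120 * (x * y^2) + c111 * (x * y * z)
       + c102 * (x * z^2) + c030 * y^3 + c021 * (y^2 * z) + c012 * (y * z^2) + c003 * z^3"
    by (rule det_pencil_expansion[of h0 a b])
  \<comment> \<open>Here the contributions of \<open>a\<close> and \<open>b\<close> at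
    \<open>v\<close> cancel.\<close>
  have det1: "det (cscale x h0 + cscale (-\<i> * y) a + cscale y b) = 0" for x y :: real
    by (rule det_eq_0_if_kernel[OF _ v(1)])
      (simp add: matrix_vector_mult_add_rdistrib cscale_mult_vec v vec.scale_eq_0_iff
        del: cscale.scale_minus_left)
  \<comment> \<open>These are the adjoints of the previous matrices, so their images are orthogonal
    to \<open>v\<close>.\<close>
  have det2: "det (cscale x h0 + cscale (\<i> * y) a + cscale y b) = 0" for x y :: real
  proof (rule singular_if_image_orthogonal[OF v(1)])
    fix u
    have P: "x *\<^sub>R h0 + y *\<^sub>R b \<in> W" and Q: "y *\<^sub>R a \<in> W"
      using W W_comb[of a a y 0] by (auto intro: W_comb)
    have "cscale x h0 + cscale (\<i> * y) a + cscale y b = (x *\<^sub>R h0 + y *\<^sub>R b) + cscale \<i> (y *\<^sub>R a)"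
      by (simp add: algebra_simps flip: cscale_of_real)
    then have "H ((cscale x h0 + cscale (\<i> * y) a + cscale y b) *v u) v
        = H u (((x *\<^sub>R h0 + y *\<^sub>R b) + cscale (-\<i>) (y *\<^sub>R a)) *v v)"
      using star[OF P Q] by simp
    also have "((x *\<^sub>R h0 + y *\<^sub>R b) + cscale (-\<i>) (y *\<^sub>R a)) *v v = 0"
      by (simp only: matrix_vector_mult_add_rdistrib scaleR_mult_vec cscale_mult_vec v)
        (simp add: vec_eq_iff algebra_simps)
    finally show "H ((cscale x h0 + cscale (\<i> * y) a + cscale y b) *v u) v = 0"
      by (simp add: H_right)
  qed
  have 1: "c300 * x^3 + (\<i> * - c210 + c201) * (x^2 * y) + (- (\<i> * c111) + (c102 - c120)) * (x * y^2)
      + (\<i> * (c030 - c012) + (c003 - c021)) * y^3 = 0" for x y :: real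
    using det1[of x y] unfolding c[rule_format] by (simp add: algebra_simps power2_eq_square power3_eq_cube)
  have 2: "c300 * x^3 + (- (\<i> * - c210) + c201) * (x^2 * y) + (\<i> * c111 + (c102 - c120)) * (x * y^2)
      + (- (\<i> * (c030 - c012)) + (c003 - c021)) * y^3 = 0" for x y :: real
    using det2[of x y] unfolding c[rule_format] by (simp add: algebra_simps power2_eq_square power3_eq_cube)
  note e1 = binary_cubic_eq_0[OF 1] and e2 = binary_cubic_eq_0[OF 2]
  \<comment> \<open>Comparing the two restrictions leaves exactly the multiples of
    \<open>s^2 + t^2\<close>.\<close>
  have "c300 = 0" "c210 = 0" "c201 = 0" "c111 = 0" "c102 = c120" "c012 = c030" "c021 = c003"
    using e1(1) conjugate_pair_eq_0[OF e1(2) e2(2)] conjugate_pair_eq_0[OF e2(3) e1(3)]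
      conjugate_pair_eq_0[OF e1(4) e2(4)] by simp_all
  then have d: "det (x *\<^sub>R h0 + s *\<^sub>R a + t *\<^sub>R b) = (s\<^sup>2 + t\<^sup>2) * (c120 * x + c030 * s + c003 * t)"
    for x s t :: real
    using c[rule_format, of x s t] by (simp add: cscale_of_real algebra_simps power2_eq_square power3_eq_cube)
  have W3: "x *\<^sub>R h0 + s *\<^sub>R a + t *\<^sub>R b \<in> W" for x s t
    using W W_subspace by (simp add: subspace_add subspace_scale)
  have real: "(s\<^sup>2 + t\<^sup>2) * (c120 * x + c030 * s + c003 * t) \<in> \<real>" for x s t :: real
    using W_det_real[OF W3[of x s t]] unfolding d .
  \<comment> \<open>The values at \<open>(x, s, t)\<close> equal to \<open>(0, 1, 0)\<close>,
    \<open>(0, 0, 1)\<close> and \<open>(1, 1, 0)\<close>.\<close>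
  have "c030 \<in> \<real>" "c003 \<in> \<real>" "c120 + c030 \<in> \<real>"
    using real[of 1 0 0] real[of 0 1 0] real[of 1 0 1] by simp_all
  moreover from this have "c120 \<in> \<real>" using Reals_diff[of "c120 + c030" c030] by simp
  ultimately obtain \<alpha> \<beta> \<gamma> where "c120 = of_real \<alpha>" "c030 = of_real \<beta>" "c003 = of_real \<gamma>"
    by (auto elim!: Reals_cases)
  with d show thesis by (intro that[of \<alpha> \<beta> \<gamma>]) simp
qed

text \<open>The factor \<open>s^2 + t^2\<close> of the cubic has \<open>h0\<close> as its only real
  point. If the linear factor vanishes at \<open>h0\<close>, all singular elements lie in a subspace
  \<open>Z\<close> of singular elements, although they span \<open>W\<close>. Otherwise the real
  cubic is the point \<open>h0\<close> plus the line of the linear factor.\<close>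

lemma W_image_not_line:
  assumes v: "v \<noteq> 0" and img: "\<And>h. h \<in> W \<Longrightarrow> \<exists>z. h *v v = z *s u"
  shows False
proof -
  obtain h0 a b where W: "h0 \<in> W" "a \<in> W" "b \<in> W" and h0: "h0 \<noteq> 0" "h0 *v v = 0"
    and ab: "a *v v \<noteq> 0" "b *v v = \<i> *s (a *v v)"
    and decomp: "\<And>h. h \<in> W \<Longrightarrow> \<exists>x s t. h = x *\<^sub>R h0 + s *\<^sub>R a + t *\<^sub>R b"
    using conjugate_pencils[OF v img] by blast
  obtain \<alpha> \<beta> \<gamma> where det: "\<And>x s t. det (x *\<^sub>R h0 + s *\<^sub>R a + t *\<^sub>R b)
      = of_real ((s\<^sup>2 + t\<^sup>2) * (\<alpha> * x + \<beta> * s + \<gamma> * t))"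
    using det_factorization[OF W v h0(2) ab(2)] by blast
  have W3: "x *\<^sub>R h0 + s *\<^sub>R a + t *\<^sub>R b \<in> W" for x s t
    using W W_subspace by (simp add: subspace_add subspace_scale)
  show False
  proof (cases "\<alpha> = 0")
    case True
    define Z where "Z = {x *\<^sub>R h0 + s *\<^sub>R a + t *\<^sub>R b | x s t. \<beta> * s + \<gamma> * t = 0}"
    have "subspace Z"
      unfolding subspace_def
    proof (intro conjI ballI allI)
      show "0 \<in> Z" unfolding Z_def
        by (rule CollectI, intro exI[of _ 0]) simp
    next
      fix h k assume "h \<in> Z" "k \<in> Z"
      then obtain x s t x' s' t' where
        h: "h = x *\<^sub>R h0 + s *\<^sub>R a + t *\<^sub>R b" "\<beta> * s + \<gamma> * t = 0" and
        k: "k = x' *\<^sub>R h0 + s' *\<^sub>R a + t' *\<^sub>R b" "\<beta> * s' + \<gamma> * t' = 0"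
        unfolding Z_def by blast
      have "h + k = (x + x') *\<^sub>R h0 + (s + s') *\<^sub>R a + (t + t') *\<^sub>R b"
        by (simp add: h k scaleR_left_distrib)
      moreover have "\<beta> * (s + s') + \<gamma> * (t + t') = 0"
        using h(2) k(2) by (simp add: algebra_simps)
      ultimately show "h + k \<in> Z" unfolding Z_def by blast
    next
      fix c h assume "h \<in> Z"
      then obtain x s t where h: "h = x *\<^sub>R h0 + s *\<^sub>R a + t *\<^sub>R b" "\<beta> * s + \<gamma> * t = 0"
        unfolding Z_def by blast
      have "c *\<^sub>R h = (c * x) *\<^sub>R h0 + (c * s) *\<^sub>R a + (c * t) *\<^sub>R b"
        by (simp add: h scaleR_right_distrib)
      moreover have "\<beta> * (c * s) + \<gamma> * (c * t) = c * (\<beta> * s + \<gamma> * t)"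
        by (simp add: algebra_simps)
      then have "\<beta> * (c * s) + \<gamma> * (c * t) = 0" by (simp add: h)
      ultimately show "c *\<^sub>R h \<in> Z" unfolding Z_def by blast
    qed
    moreover have "degenerate_part W \<subseteq> Z"
    proof
      fix h assume "h \<in> degenerate_part W"
      then have h: "h \<in> W" "det h = 0" by (simp_all add: degenerate_part_def)
      then obtain x s t where hd: "h = x *\<^sub>R h0 + s *\<^sub>R a + t *\<^sub>R b" using decomp by blast
      have "(s\<^sup>2 + t\<^sup>2) * (\<alpha> * x + \<beta> * s + \<gamma> * t) = 0"
        using h(2) unfolding hd det by (simp only: of_real_eq_0_iff)
      then have "\<beta> * s + \<gamma> * t = 0"
        by (auto simp: True sum_power2_eq_zero_iff)
      then show "h \<in> Z" unfolding Z_def hd by blast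
    qed
    ultimately have "span (degenerate_part W) \<subseteq> Z" by (intro span_minimal)
    then have WZ: "W \<subseteq> Z" using bisector by (simp add: bisector_family_def)
    obtain h where h: "h \<in> W" "det h \<noteq> 0" using W_det_nonzero by blast
    then obtain x s t where "h = x *\<^sub>R h0 + s *\<^sub>R a + t *\<^sub>R b" "\<beta> * s + \<gamma> * t = 0"
      using WZ unfolding Z_def by blast
    with h(2) det[of x s t] True show False by simp
  next
    case False
    \<comment> \<open>As the linear factor is nonzero at \<open>h0\<close>, multiples of
      \<open>h0\<close> move \<open>a\<close> and \<open>b\<close> into its zero set.\<close>
    define P where "P = a - (\<beta> / \<alpha>) *\<^sub>R h0"
    define Q where "Q = b - (\<gamma> / \<alpha>) *\<^sub>R h0"
    have PQ: "r *\<^sub>R P + s *\<^sub>R Q = (- (\<beta> * r + \<gamma> * s) / \<alpha>) *\<^sub>R h0 + r *\<^sub>R a + s *\<^sub>R b" for r s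
      unfolding P_def Q_def by (simp add: algebra_simps add_divide_distrib diff_divide_distrib)
    have detPQ: "det (r *\<^sub>R P + s *\<^sub>R Q) = 0" for r s
      unfolding PQ det using False by simp
    \<comment> \<open>So a nonzero combination of \<open>P\<close> and \<open>Q\<close> does not
      kill \<open>v\<close>, unlike \<open>h0\<close>; this yields both independence and
      \<open>h0\<close> off the line.\<close>
    have PQv: "(r *\<^sub>R P + s *\<^sub>R Q) *v v = Complex r s *s (a *v v)" for r s
      unfolding PQ
      by (simp only: matrix_vector_mult_add_rdistrib scaleR_mult_vec h0 ab(2))
        (simp add: vec_eq_iff Complex_eq algebra_simps)
    have dim: "dim (span {P, Q}) = 2"
    proof (rule dim_span_pair)
      fix r s assume "r *\<^sub>R P + s *\<^sub>R Q = 0"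
      then have "Complex r s *s (a *v v) = 0" using PQv[of r s] by simp
      with ab(1) show "r = 0 \<and> s = 0" by (simp add: vec.scale_eq_0_iff Complex_eq_0)
    qed
    have h0_notin: "h0 \<notin> span {P, Q}"
    proof
      assume "h0 \<in> span {P, Q}"
      then obtain r s where rs: "h0 = r *\<^sub>R P + s *\<^sub>R Q" unfolding in_span_pair by blast
      then have "Complex r s *s (a *v v) = 0" using PQv[of r s] h0(2) by simp
      with ab(1) have "r = 0 \<and> s = 0" by (simp add: vec.scale_eq_0_iff Complex_eq_0)
      with rs h0(1) show False by simp
    qed
    have sub: "span {P, Q} \<subseteq> W"
      unfolding subset_iff in_span_pair PQ using W3 by blast
    have cubic: "real_cubic W = insert (line scaleR h0) (proj scaleR (span {P, Q}))"
    proof (intro equalityI subsetI)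
      fix l assume "l \<in> real_cubic W"
      then obtain h where h: "h \<in> W" "det h = 0" "h \<noteq> 0" and l: "l = line scaleR h"
        unfolding real_cubic_def proj_zeros_def proj_def by blast
      obtain x s t where hd: "h = x *\<^sub>R h0 + s *\<^sub>R a + t *\<^sub>R b" using decomp h(1) by blast
      have "(s\<^sup>2 + t\<^sup>2) * (\<alpha> * x + \<beta> * s + \<gamma> * t) = 0"
        using h(2) unfolding hd det by (simp only: of_real_eq_0_iff)
      then consider "s = 0" "t = 0" | "\<alpha> * x + \<beta> * s + \<gamma> * t = 0"
        by (auto simp: sum_power2_eq_zero_iff)
      then show "l \<in> insert (line scaleR h0) (proj scaleR (span {P, Q}))"
      proof cases
        case 1
        with hd h(3) have hx: "h = x *\<^sub>R h0" "x \<noteq> 0" by auto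
        have "line scaleR h = line scaleR h0"
        proof -
          have "c *\<^sub>R h0 = (c / x) *\<^sub>R h" for c using hx by simp
          then have "c *\<^sub>R h0 \<in> line scaleR h" for c unfolding line_def by (metis rangeI)
          moreover have "c *\<^sub>R h \<in> line scaleR h0" for c
            unfolding line_def hx(1) by (metis rangeI scaleR_scaleR)
          ultimately show ?thesis unfolding line_def by blast
        qed
        then show ?thesis by (simp add: l)
      next
        case 2
        then have "x = - (\<beta> * s + \<gamma> * t) / \<alpha>" using False by (simp add: field_simps)
        then have "h = s *\<^sub>R P + t *\<^sub>R Q" unfolding PQ hd by simp
        then have "h \<in> span {P, Q}" unfolding in_span_pair by blast
        then show ?thesis using h(3) unfolding l proj_def by blast
      qed
    next
      fix l assume "l \<in> insert (line scaleR h0) (proj scaleR (span {P, Q}))"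
      then consider "l = line scaleR h0" | h where "h \<in> span {P, Q}" "h \<noteq> 0" "l = line scaleR h"
        unfolding proj_def by blast
      then show "l \<in> real_cubic W"
      proof cases
        case 1
        have "det h0 = 0" using det_eq_0_if_kernel h0(2) v by blast
        then show ?thesis using 1 W(1) h0(1)
          unfolding real_cubic_def proj_zeros_def proj_def by blast
      next
        case 2
        then have "h \<in> W" using sub by blast
        moreover have "det h = 0" using 2(1) detPQ unfolding in_span_pair by blast
        moreover note 2(2,3)
        ultimately show ?thesis
          unfolding real_cubic_def proj_zeros_def proj_def by blast
      qed
    qed
    have "line_plus_point W"
      unfolding line_plus_point_def
      using dim h0_notin sub cubic W(1) subspace_span by blast
    with generic show False by (simp add: generic_elliptic_family_def)
  qed
qed

end

section \<open>Locally dependent spaces of matrices\<close>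

lemma cdot_cross_eq_trip: "cdot (cross x y) z = trip x y z"
  by (simp add: cross_defs)

lemma trip_cramer: "trip p q r *s z = trip z q r *s p + trip p z r *s q + trip p q z *s r"
  by (simp add: cross_defs)

lemma trip_repeat: "trip x x y = 0" "trip x y x = 0" "trip x y y = 0"
  by (simp_all add: cross_defs)

lemma trip_rotate: "trip x y z = trip y z x"
  by (simp add: cross_defs)

lemma trip_swap: "trip x y z = - trip x z y"
  by (simp add: cross_defs)

lemma trip_matrix_mult: "trip (g *v x) (g *v y) (g *v z) = det g * trip x y z"
  by (simp add: mat_vec_component cross_defs det_3)

text \<open>The value \<open>s = 0\<close> is left out because a factor \<open>s\<close> is
  cancelled where this is applied.\<close>

lemma quadratic_eq_0:
  fixes p q r :: complex
  assumes "\<And>s. s \<noteq> 0 \<Longrightarrow> p + s * q + s^2 * r = 0"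
  shows "p = 0" "q = 0" "r = 0"
proof -
  have 1: "p + q + r = 0" using assms[of 1] by simp
  have 2: "p - q + r = 0" using assms[of "-1"] by simp
  have "q + q = 0" using arg_cong2[OF 1 2, of "(-)"] by simp
  then show q: "q = 0" by (simp flip: mult_2)
  have p: "p = - r" using 1 q by (simp add: eq_neg_iff_add_eq_0)
  have "p + 4 * r = 0" using assms[of 2] q by simp
  then have "3 * r = 0" by (simp add: p)
  then show "r = 0" by simp
  with p show "p = 0" by simp
qed

text \<open>These properties survive multiplication of the whole space by an invertible matrix,
  which later allows an element to be normalised to the identity.\<close>

locale rank_two_space =
  fixes R :: "mat3 set"
  assumes comb: "\<And>h k c. h \<in> R \<Longrightarrow> k \<in> R \<Longrightarrow> h + cscale c k \<in> R"
    and no_rank_one: "\<And>h u w. h \<in> R \<Longrightarrow> (\<And>x. h *v x = cdot w x *s u) \<Longrightarrow> h = 0"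
    and image_not_line: "\<And>v u. v \<noteq> 0 \<Longrightarrow> (\<And>h. h \<in> R \<Longrightarrow> \<exists>z. h *v v = z *s u) \<Longrightarrow> False"
begin

text \<open>All rows of \<open>h\<close> are orthogonal to \<open>v\<close> and \<open>w\<close>,
  hence multiples of \<open>cross v w\<close>, so \<open>h\<close> has rank at most one.\<close>

lemma kills_independent:
  assumes h: "h \<in> R" and v: "h *v v = 0" "h *v w = 0" "cross v w \<noteq> 0"
  shows "h = 0"
proof -
  have "\<exists>c. h $ i = c *s cross v w" for i
  proof -
    have "cdot v (h $ i) = (h *v v) $ i" "cdot w (h $ i) = (h *v w) $ i"
      by (simp_all add: mat_vec_component cdot_def mult.commute)
    then show ?thesis using orthogonal_pair_proportional[of v "h $ i" w] v by auto
  qed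
  then obtain c where c: "\<And>i. h $ i = c i *s cross v w" by metis
  show ?thesis
  proof (rule no_rank_one[OF h])
    show "h *v x = cdot (cross v w) x *s vec_lambda c" for x
      by (simp add: vec_eq_iff mat_vec_component c cdot_simps mult.commute)
  qed
qed

end

text \<open>
  If \<open>v\<close>, \<open>A v\<close>, \<open>B v\<close> are always dependent, differentiating along \<open>v + s A v\<close> shows that
  either some element has rank one or \<open>v\<close> spans an invariant plane together with \<open>A v\<close>.
\<close>

locale locally_dependent_space = rank_two_space +
  assumes one: "mat 1 \<in> R"
    and dependent: "\<And>h k l v. h \<in> R \<Longrightarrow> k \<in> R \<Longrightarrow> l \<in> R \<Longrightarrow> trip (h *v v) (k *v v) (l *v v) = 0"
    and kernel: "\<And>v. \<exists>h\<in>R. h \<noteq> 0 \<and> h *v v = 0"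
begin

lemma dependent_derivative:
  assumes A: "A \<in> R" and B: "B \<in> R" "B *v v = 0"
  shows "trip v (A *v v) (B *v (A *v v)) = 0"
    and "trip v (A *v (A *v v)) (B *v (A *v v)) = 0"
    and "trip (A *v v) (A *v (A *v v)) (B *v (A *v v)) = 0"
proof -
  let ?w = "A *v v"
  \<comment> \<open>The dependence of the images of \<open>v + s *s ?w\<close> is expanded in
    \<open>s\<close>. As \<open>B *v v = 0\<close>, a factor \<open>s\<close> splits off.\<close>
  have "trip v ?w (B *v ?w) + s * trip v (A *v ?w) (B *v ?w) + s^2 * trip ?w (A *v ?w) (B *v ?w) = 0"
    if "s \<noteq> 0" for s
  proof -
    have "0 = trip (mat 1 *v (v + s *s ?w)) (A *v (v + s *s ?w)) (B *v (v + s *s ?w))"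
      using dependent[OF one A B(1)] by simp
    also have "\<dots> = s * (trip v ?w (B *v ?w) + s * trip v (A *v ?w) (B *v ?w)
        + s^2 * trip ?w (A *v ?w) (B *v ?w))"
      by (simp add: matrix_vector_right_distrib vector_scalar_commute B(2) trip_linear trip_repeat algebra_simps power2_eq_square)
    finally show ?thesis using that by simp
  qed
  note q = quadratic_eq_0[OF this]
  show "trip v (A *v v) (B *v (A *v v)) = 0"
    "trip v (A *v (A *v v)) (B *v (A *v v)) = 0"
    "trip (A *v v) (A *v (A *v v)) (B *v (A *v v)) = 0"
    by (rule q; assumption)+
qed

text \<open>The plane is spanned by \<open>v\<close> and \<open>w = A *v v\<close>. The space maps
  \<open>v\<close> into it by dependence with \<open>1\<close> and \<open>A\<close>; for
  \<open>w\<close>, an element is first corrected to kill \<open>v\<close>, where the derivative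
  applies.\<close>

lemma invariant_plane:
  assumes v: "v \<noteq> 0"
  obtains n where "n \<noteq> 0" "cdot n v = 0"
    "\<And>h x. h \<in> R \<Longrightarrow> cdot n x = 0 \<Longrightarrow> cdot n (h *v x) = 0"
proof -
  obtain B where B: "B \<in> R" "B \<noteq> 0" "B *v v = 0" using kernel by blast
  have "\<exists>A\<in>R. cross v (A *v v) \<noteq> 0"
  proof (rule ccontr)
    assume "\<not> ?thesis"
    then have "\<exists>z. h *v v = z *s v" if "h \<in> R" for h
      using cross_eq_0_imp_proportional[OF _ v] that by metis
    then show False using image_not_line v by blast
  qed
  then obtain A where A: "A \<in> R" and n: "cross v (A *v v) \<noteq> 0" by blast
  define w where "w = A *v v"
  note derivative = dependent_derivative[OF A, of _ v, folded w_def]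
  \<comment> \<open>If \<open>v\<close>, \<open>w\<close>, \<open>A *v w\<close> were a basis, the
    three derivatives would make all coordinates of \<open>B *v w\<close> vanish, and
    \<open>B\<close> would kill two independent vectors.\<close>
  have cyc: "trip v w (A *v w) = 0"
  proof (rule ccontr)
    assume ne: "trip v w (A *v w) \<noteq> 0"
    have "trip v w (A *v w) *s (B *v w) = 0"
      using derivative[OF B(1,3)]
      by (simp add: trip_cramer[of v] trip_rotate[of "B *v w"] trip_swap[of v "B *v w"])
    then have "B *v w = 0" using ne by (simp add: vec.scale_eq_0_iff)
    with kills_independent[OF B(1,3)] n B(2) show False by (simp add: w_def)
  qed
  have v_in: "trip v w (h *v v) = 0" if "h \<in> R" for h
    using dependent[OF one A that, of v] by (simp add: w_def)
  have w_in: "trip v w (h *v w) = 0" if h: "h \<in> R" for h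
  proof -
    obtain a b where ab: "h *v v = a *s v + b *s w"
      using trip_eq_0_imp_in_span[OF v_in[OF h]] n unfolding w_def by blast
    \<comment> \<open>The correction by multiples of the identity and \<open>A\<close> that kills
      \<open>v\<close>.\<close>
    define B' where "B' = (h + cscale (- a) (mat 1)) + cscale (- b) A"
    have B': "B' *v x = h *v x - a *s x - b *s (A *v x)" for x
      unfolding B'_def
      by (simp add: matrix_vector_mult_add_rdistrib matrix_vector_mult_diff_rdistrib cscale_mult_vec)
    have "B' \<in> R" unfolding B'_def by (intro comb h one A)
    moreover have "B' *v v = 0" unfolding B' ab by (simp flip: w_def)
    ultimately have "trip v w (B' *v w) = 0" by (rule derivative(1))
    moreover have "h *v w = B' *v w + a *s w + b *s (A *v w)" by (simp add: B')
    ultimately show ?thesis by (simp add: trip_linear trip_repeat cyc)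
  qed
  show thesis
  proof (rule that)
    show "cross v w \<noteq> 0" using n by (simp add: w_def)
    show "cdot (cross v w) v = 0" by (simp add: cdot_cross_eq_trip trip_repeat)
    fix h x assume h: "h \<in> R" and x: "cdot (cross v w) x = 0"
    obtain a b where "x = a *s v + b *s w"
      using trip_eq_0_imp_in_span x n unfolding w_def cdot_cross_eq_trip by blast
    then show "cdot (cross v w) (h *v x) = 0"
      by (simp add: cdot_cross_eq_trip matrix_vector_right_distrib vector_scalar_commute trip_linear v_in[OF h] w_in[OF h])
  qed
qed

text \<open>The second invariant plane passes through a vector outside the first, so the planes
  differ and meet in a line that every element preserves, against
  \<open>image_not_line\<close>.\<close>

lemma contradiction: False
proof -
  have "axis 1 1 \<noteq> (0 :: vec3)" by (simp add: vec_eq_iff axis_def)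
  then obtain n0 where n0: "n0 \<noteq> 0"
    "\<And>h x. h \<in> R \<Longrightarrow> cdot n0 x = 0 \<Longrightarrow> cdot n0 (h *v x) = 0"
    by (metis invariant_plane)
  obtain i where i: "n0 $ i \<noteq> 0" using n0(1) by (metis vec_eq_iff zero_index)
  have "\<forall>i. cdot n0 (axis i 1) = n0 $ i" unfolding forall_3 by (simp add: cdot_def axis_def)
  with i have v1: "cdot n0 (axis i 1) \<noteq> 0" by simp
  then have "axis i 1 \<noteq> (0 :: vec3)" by (metis cdot_simps(5))
  then obtain n1 where n1: "n1 \<noteq> 0" "cdot n1 (axis i 1) = 0"
    "\<And>h x. h \<in> R \<Longrightarrow> cdot n1 x = 0 \<Longrightarrow> cdot n1 (h *v x) = 0"
    by (metis invariant_plane)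
  have e: "cross n0 n1 \<noteq> 0"
  proof
    assume "cross n0 n1 = 0"
    then obtain c where "n1 = c *s n0" using cross_eq_0_imp_proportional n0(1) by metis
    with n1(1,2) v1 show False by (simp add: cdot_simps)
  qed
  have "\<exists>z. h *v cross n0 n1 = z *s cross n0 n1" if "h \<in> R" for h
    using orthogonal_pair_proportional[OF n0(2)[OF that] n1(3)[OF that] e] cdot_cross_eq_0 by metis
  then show False using image_not_line e by blast
qed

end

text \<open>Multiplication by the inverse of \<open>h1\<close> brings the identity into the space
  and only rescales triple products.\<close>

lemma (in rank_two_space) not_locally_dependent:
  assumes h1: "h1 \<in> R" "det h1 \<noteq> 0"
    and dep: "\<And>h k l v. h \<in> R \<Longrightarrow> k \<in> R \<Longrightarrow> l \<in> R \<Longrightarrow> trip (h *v v) (k *v v) (l *v v) = 0"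
    and kernel: "\<And>v. \<exists>h\<in>R. h \<noteq> 0 \<and> h *v v = 0"
  shows False
proof -
  obtain g where g: "g ** h1 = mat 1" "h1 ** g = mat 1"
    using h1(2) unfolding invertible_det_nz[symmetric] invertible_def by blast
  have cancel: "h1 *v (g *v x) = x" "g *v x = 0 \<longleftrightarrow> x = 0" for x
  proof -
    show *: "h1 *v (g *v x) = x" using g by (simp add: matrix_vector_mul_assoc)
    show "g *v x = 0 \<longleftrightarrow> x = 0" using * by (metis matrix_vector_mult_0_right)
  qed
  have g_eq: "h1 *v (g ** h *v x) = h *v x" for h x
    by (simp add: cancel flip: matrix_vector_mul_assoc)
  interpret locally_dependent_space "{g ** h | h. h \<in> R}"
  proof
    fix h k c assume "h \<in> {g ** h | h. h \<in> R}" "k \<in> {g ** h | h. h \<in> R}"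
    then obtain h' k' where "h = g ** h'" "k = g ** k'" "h' \<in> R" "k' \<in> R" by blast
    moreover have "g ** h' + cscale c (g ** k') = g ** (h' + cscale c k')"
      by (simp add: matrix_eq matrix_vector_mult_add_rdistrib cscale_mult_vec matrix_vector_right_distrib vector_scalar_commute
          flip: matrix_vector_mul_assoc)
    ultimately show "h + cscale c k \<in> {g ** h | h. h \<in> R}" using comb by blast
  next
    fix h u w assume "h \<in> {g ** h | h. h \<in> R}" and hx: "\<And>x. h *v x = cdot w x *s u"
    then obtain h' where h': "h = g ** h'" "h' \<in> R" by blast
    have "h' *v x = cdot w x *s (h1 *v u)" for x
      using g_eq[of h' x] hx[of x] by (simp add: h' vector_scalar_commute)
    then have "h' = 0" using no_rank_one h'(2) by blast
    then show "h = 0" by (simp add: h' matrix_eq flip: matrix_vector_mul_assoc)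
  next
    fix v u :: vec3 assume v: "v \<noteq> 0"
      and hv: "\<And>h. h \<in> {g ** h | h. h \<in> R} \<Longrightarrow> \<exists>z. h *v v = z *s u"
    have "\<exists>z. h *v v = z *s (h1 *v u)" if h: "h \<in> R" for h
    proof -
      obtain z where "g ** h *v v = z *s u" using hv[of "g ** h"] h by blast
      then have "h *v v = z *s (h1 *v u)" using g_eq[of h v] by (simp add: vector_scalar_commute)
      then show ?thesis by blast
    qed
    then show False using image_not_line v by blast
  next
    show "mat 1 \<in> {g ** h | h. h \<in> R}" using g(1)[symmetric] h1(1) by blast
  next
    fix h k l and v :: vec3
    assume "h \<in> {g ** h | h. h \<in> R}" "k \<in> {g ** h | h. h \<in> R}" "l \<in> {g ** h | h. h \<in> R}"
    then show "trip (h *v v) (k *v v) (l *v v) = 0"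
      using dep by (auto simp: trip_matrix_mult simp flip: matrix_vector_mul_assoc)
  next
    fix v :: vec3
    obtain h where h: "h \<in> R" "h \<noteq> 0" "h *v v = 0" using kernel by blast
    have "g ** h \<noteq> 0"
    proof
      assume "g ** h = 0"
      then have "h *v x = 0" for x using g_eq[of h x] by simp
      with h(2) show False by (simp add: matrix_eq)
    qed
    moreover have "g ** h *v v = 0" using h(3) by (simp flip: matrix_vector_mul_assoc)
    ultimately show "\<exists>h\<in>{g ** h | h. h \<in> R}. h \<noteq> 0 \<and> h *v v = 0" using h(1) by blast
  qed
  show False by (rule contradiction)
qed

section \<open>The focal map\<close>

text \<open>Since \<open>focal_map\<close> takes the common kernel of a set of matrices, the same
  function serves complex and real lines.\<close>

lemma focal_map_complex_line: "focal_map (line cscale h) = {v. h *v v = 0}"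
proof -
  have "(\<forall>c. cscale c h *v v = 0) \<longleftrightarrow> h *v v = 0" for v
    by (auto simp: cscale_mult_vec dest: spec[of _ 1])
  then show ?thesis by (simp add: focal_map_def line_def)
qed

lemma focal_map_real_line: "focal_map (line scaleR h) = {v. h *v v = 0}"
proof -
  have "(\<forall>r. (r *\<^sub>R h) *v v = 0) \<longleftrightarrow> h *v v = 0" for v :: vec3
    by (auto simp: scaleR_mult_vec dest: spec[of _ 1])
  then show ?thesis by (simp add: focal_map_def line_def)
qed

lemma kernel_eq_line:
  assumes "det h = 0" "cross (h $ a) (h $ b) \<noteq> 0"
  shows "{v. h *v v = 0} = line (*s) (cross (h $ a) (h $ b))"
proof (intro equalityI subsetI)
  fix v assume "v \<in> {v. h *v v = 0}"
  then have "cdot (h $ i) v = 0" for i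
    by (simp flip: mat_vec_component)
  then obtain c where "v = c *s cross (h $ a) (h $ b)"
    using orthogonal_pair_proportional assms(2) by metis
  then show "v \<in> line (*s) (cross (h $ a) (h $ b))" unfolding line_def by blast
next
  fix v assume "v \<in> line (*s) (cross (h $ a) (h $ b))"
  then obtain c where v: "v = c *s cross (h $ a) (h $ b)" unfolding line_def by blast
  have "(h *v cross (h $ a) (h $ b)) $ i = 0" for i
    using trip_rows[of h i a b] assms(1) by (simp add: mat_vec_component trip_def)
  then have "h *v cross (h $ a) (h $ b) = 0" by (simp add: vec_eq_iff)
  then show "v \<in> {v. h *v v = 0}" by (simp add: v vector_scalar_commute)
qed

lemma linear_vec_component: "Vector_Spaces.linear (*s) (*) (\<lambda>v :: vec3. v $ i)"
  by (simp add: Vector_Spaces.linear_iff vec.vector_space_axioms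
      vector_space_over_itself.vector_space_axioms)

lemma linear_mat_component: "Vector_Spaces.linear cscale (*) (\<lambda>h. h $ i $ j)"
  by (simp add: Vector_Spaces.linear_iff cscale.vector_space_axioms
      vector_space_over_itself.vector_space_axioms)

section \<open>Coordinates on the complexification and the two kernel maps\<close>

context generic_family
begin

lemma W_basis:
  obtains b1 b2 b3 where "b1 \<in> W" "b2 \<in> W" "b3 \<in> W"
    "\<forall>h\<in>W. \<exists>x y z. h = x *\<^sub>R b1 + y *\<^sub>R b2 + z *\<^sub>R b3"
    "\<forall>x y z. x *\<^sub>R b1 + y *\<^sub>R b2 + z *\<^sub>R b3 = 0 \<longrightarrow> x = 0 \<and> y = 0 \<and> z = 0"
proof -
  obtain B where B: "B \<subseteq> W" "independent B" "W \<subseteq> span B" "card B = dim W"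
    by (rule basis_exists)
  then obtain b1 b2 b3 where b: "B = {b1, b2, b3}" "b1 \<noteq> b2" "b1 \<noteq> b3" "b2 \<noteq> b3"
    unfolding W_dim card_3_iff by blast
  have gen: "\<forall>h\<in>W. \<exists>x y z. h = x *\<^sub>R b1 + y *\<^sub>R b2 + z *\<^sub>R b3"
  proof
    fix h assume "h \<in> W"
    then have "h \<in> span {b1, b2, b3}" using B(3) b(1) by blast
    then obtain x y z where "h - x *\<^sub>R b1 - y *\<^sub>R b2 = z *\<^sub>R b3"
      by (auto simp: span_breakdown_eq span_singleton)
    then have "h = x *\<^sub>R b1 + y *\<^sub>R b2 + z *\<^sub>R b3" by (simp add: algebra_simps)
    then show "\<exists>x y z. h = x *\<^sub>R b1 + y *\<^sub>R b2 + z *\<^sub>R b3" by blast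
  qed
  have indep: "\<forall>x y z. x *\<^sub>R b1 + y *\<^sub>R b2 + z *\<^sub>R b3 = 0 \<longrightarrow> x = 0 \<and> y = 0 \<and> z = 0"
  proof (intro allI impI)
    fix x y z assume xyz: "x *\<^sub>R b1 + y *\<^sub>R b2 + z *\<^sub>R b3 = 0"
    define u where "u v = (if v = b1 then x else if v = b2 then y else z)" for v
    have "(\<Sum>v\<in>B. u v *\<^sub>R v) = 0"
      using xyz b(2-4) by (simp add: b(1) u_def add.assoc)
    moreover have "finite B" by (simp add: b(1))
    ultimately have "\<forall>v\<in>B. u v = 0" using real_vector.independentD[OF B(2)] by auto
    then show "x = 0 \<and> y = 0 \<and> z = 0" using b by (simp add: u_def)
  qed
  show thesis using B(1) b(1) by (intro that[OF _ _ _ gen indep]) auto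
qed

text \<open>A real basis of \<open>W\<close> is a complex basis of the complexification by
  \<open>totally_real\<close>. Column \<open>j\<close> of \<open>N v\<close> is the image of
  \<open>v\<close> under the basis element \<open>bj\<close>, so \<open>lin\<close> and
  \<open>N\<close> are two readings of one tensor.\<close>

lemma complexification_parametrization:
  obtains lin :: "vec3 \<Rightarrow> mat3" and X :: "mat3 \<Rightarrow> vec3" and N :: "vec3 \<Rightarrow> mat3" where
    "Vector_Spaces.linear (*s) cscale lin" "range lin = complexification W"
    "Vector_Spaces.linear cscale (*s) X" "\<forall>x. X (lin x) = x"
    "\<forall>i j. Vector_Spaces.linear (*s) (*) (\<lambda>v. N v $ i $ j)"
    "\<forall>v x. N v *v x = lin x *v v"
proof -
  obtain b1 b2 b3 where b: "b1 \<in> W" "b2 \<in> W" "b3 \<in> W"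
    and gen: "\<forall>h\<in>W. \<exists>x y z. h = x *\<^sub>R b1 + y *\<^sub>R b2 + z *\<^sub>R b3"
    and indep: "\<forall>x y z. x *\<^sub>R b1 + y *\<^sub>R b2 + z *\<^sub>R b3 = 0 \<longrightarrow> x = 0 \<and> y = 0 \<and> z = 0"
    by (rule W_basis)
  have W3: "x *\<^sub>R b1 + y *\<^sub>R b2 + z *\<^sub>R b3 \<in> W" for x y z
    using b W_subspace by (simp add: subspace_add subspace_scale)
  define lin :: "vec3 \<Rightarrow> mat3" where
    "lin x = cscale (x$1) b1 + cscale (x$2) b2 + cscale (x$3) b3" for x
  have split: "lin x = (Re (x$1) *\<^sub>R b1 + Re (x$2) *\<^sub>R b2 + Re (x$3) *\<^sub>R b3)
      + cscale \<i> (Im (x$1) *\<^sub>R b1 + Im (x$2) *\<^sub>R b2 + Im (x$3) *\<^sub>R b3)" for x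
  proof -
    have "cscale z A = Re z *\<^sub>R A + cscale \<i> (Im z *\<^sub>R A)" for z A
    proof -
      have "z = complex_of_real (Re z) + \<i> * complex_of_real (Im z)" by (rule complex_eq)
      then have "cscale z A = cscale (complex_of_real (Re z) + \<i> * complex_of_real (Im z)) A" by simp
      also have "\<dots> = Re z *\<^sub>R A + cscale \<i> (Im z *\<^sub>R A)"
        by (simp only: cscale.scale_left_distrib flip: cscale_of_real cscale.scale_scale)
      finally show ?thesis .
    qed
    from this[of "x$1" b1] this[of "x$2" b2] this[of "x$3" b3] show ?thesis
      unfolding lin_def by (simp add: cscale.scale_right_distrib)
  qed
  have lin: "Vector_Spaces.linear (*s) cscale lin"
    by (simp add: Vector_Spaces.linear_iff cscale.vector_space_axioms vec.vector_space_axioms lin_def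
        cscale.scale_left_distrib cscale.scale_right_distrib)
  have "range lin \<subseteq> complexification W"
    unfolding complexification_def using split W3 by blast
  moreover have "complexification W \<subseteq> range lin"
  proof
    fix h assume "h \<in> complexification W"
    then obtain A B where AB: "A \<in> W" "B \<in> W" "h = A + cscale \<i> B"
      unfolding complexification_def by blast
    obtain x y z where A: "A = x *\<^sub>R b1 + y *\<^sub>R b2 + z *\<^sub>R b3" using gen AB(1) by blast
    obtain x' y' z' where B: "B = x' *\<^sub>R b1 + y' *\<^sub>R b2 + z' *\<^sub>R b3" using gen AB(2) by blast
    have "h = lin (vector [Complex x x', Complex y y', Complex z z'])"
      unfolding split by (simp add: AB(3) A B)
    then show "h \<in> range lin" by blast
  qed
  ultimately have range: "range lin = complexification W" by blast
  have ker: "x = 0" if "lin x = 0" for x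
  proof -
    note z = totally_real[OF W3 W3 that[unfolded split]]
    have "Re (x$1) = 0 \<and> Re (x$2) = 0 \<and> Re (x$3) = 0" using indep z(1) by blast
    moreover have "Im (x$1) = 0 \<and> Im (x$2) = 0 \<and> Im (x$3) = 0" using indep z(2) by blast
    ultimately show ?thesis by (simp add: vec_eq_iff forall_3 complex_eq_iff)
  qed
  interpret pair: vector_space_pair "(*s) :: complex \<Rightarrow> vec3 \<Rightarrow> vec3" cscale
    by unfold_locales
  have "inj lin"
  proof (rule injI)
    fix x y assume "lin x = lin y"
    then have "lin (x - y) = 0"
      using module_hom.diff[OF lin[unfolded linear_iff_module_hom], of x y] by simp
    then show "x = y" using ker by fastforce
  qed
  \<comment> \<open>The coordinates are extended linearly to all matrices, as homogeneous functions
    live on the ambient space.\<close>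
  then obtain X where X: "Vector_Spaces.linear cscale (*s) X" "X \<circ> lin = id"
    using pair.linear_injective_left_inverse[OF lin] by blast
  define N :: "vec3 \<Rightarrow> mat3" where
    "N v = (\<chi> i j. ((if j = 1 then b1 else if j = 2 then b2 else b3) *v v) $ i)" for v
  show thesis
  proof (rule that[OF lin range X(1)])
    show "\<forall>x. X (lin x) = x" using X(2) by (metis comp_apply id_apply)
    show "\<forall>i j. Vector_Spaces.linear (*s) (*) (\<lambda>v. N v $ i $ j)"
      by (simp add: N_def Vector_Spaces.linear_iff vec.vector_space_axioms
          vector_space_over_itself.vector_space_axioms matrix_vector_right_distrib vector_scalar_commute)
    show "\<forall>v x. N v *v x = lin x *v v"
      by (simp add: vec_eq_iff mat_vec_component cdot_def N_def lin_def algebra_simps)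
  qed
qed

lemma W_subset_complexification: "W \<subseteq> complexification W"
proof
  fix h assume "h \<in> W"
  moreover have "h = h + cscale \<i> 0" by simp
  moreover have "0 \<in> W" using W_subspace by (rule subspace_0)
  ultimately show "h \<in> complexification W" unfolding complexification_def by blast
qed

lemma focal_map_extends: "\<exists>G. cubic_isomorphism cscale (complexification W) det (*s) UNIV G focal_map"
proof -
  let ?U = "complexification W"
  obtain lin :: "vec3 \<Rightarrow> mat3" and X and N :: "vec3 \<Rightarrow> mat3" where lin: "Vector_Spaces.linear (*s) cscale lin" and range: "range lin = ?U"
    and X: "Vector_Spaces.linear cscale (*s) X" and X_lin: "\<forall>x. X (lin x) = x"
    and N: "\<forall>i j. Vector_Spaces.linear (*s) (*) (\<lambda>v. N v $ i $ j)"
    and N_lin: "\<forall>v x. N v *v x = lin x *v v"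
    by (rule complexification_parametrization)
  have lin_add: "lin (x + y) = lin x + lin y" and lin_scale: "lin (c *s x) = cscale c (lin x)" for x y c
    using lin by (simp_all add: Vector_Spaces.linear_iff)
  have lin_X: "lin (X h) = h" if "h \<in> ?U" for h
    using that X_lin unfolding range[symmetric] by auto
  have lin_0: "x = 0" if "lin x = 0" for x
    using lin_scale[of 0 x] X_lin that by (metis cscale.scale_zero_left vec.scale_zero_left)
  have comb: "h + cscale c k \<in> ?U" if "h \<in> ?U" "k \<in> ?U" for h k c
  proof -
    have "h + cscale c k = lin (X h + c *s X k)"
      using that by (simp add: lin_add lin_scale lin_X)
    then show ?thesis unfolding range[symmetric] by blast
  qed
  interpret rk: rank_two_space ?U
  proof
    show "h = 0" if "h \<in> ?U" "\<And>x. h *v x = cdot w x *s u" for h u w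
      using no_rank_one that by blast
    show False if "v \<noteq> 0" "\<And>h. h \<in> ?U \<Longrightarrow> \<exists>z. h *v v = z *s u" for v u
      using W_image_not_line that W_subset_complexification by (meson subsetD)
  qed (rule comb)
  have minor_U: "\<exists>a b. cross (h $ a) (h $ b) \<noteq> 0" if "h \<in> ?U" "h \<noteq> 0" for h
    using rank_one_if_minors_vanish[of h] rk.no_rank_one that by metis
  have minor_V: "\<exists>a b. cross (N v $ a) (N v $ b) \<noteq> 0" if v: "v \<noteq> 0" for v
  proof (rule ccontr)
    assume "\<not> ?thesis"
    then obtain u w where uw: "\<And>x. N v *v x = cdot w x *s u"
      using rank_one_if_minors_vanish[of "N v"] by metis
    have "\<exists>z. h *v v = z *s u" if "h \<in> ?U" for h
      using uw[of "X h"] N_lin lin_X[OF that] by metis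
    then show False using rk.image_not_line v by blast
  qed
  \<comment> \<open>The tensor read as the matrices \<open>h\<close> themselves; the kernel map goes
    from singular \<open>h\<close> to vectors.\<close>
  interpret t1: tensor cscale ?U "\<lambda>h. h" X lin "(*s)" UNIV N "\<lambda>v. v"
  proof (rule tensor.intro)
    show "Vector_Spaces.linear cscale (*) (\<lambda>x. X x $ i)" for i
      by (rule linear_compose_functional[OF X linear_vec_component])
    show "Vector_Spaces.linear (*s) (*s) (\<lambda>v :: vec3. v)"
      by (simp add: Vector_Spaces.linear_iff vec.vector_space_axioms)
  qed (use lin N N_lin lin_X minor_U linear_mat_component in auto)
  \<comment> \<open>The same tensor with the two factors exchanged, giving the kernel map from
    \<open>v\<close> back to \<open>h\<close>.\<close>
  interpret t2: tensor "(*s)" UNIV N "\<lambda>v. v" "\<lambda>v. v" cscale ?U "\<lambda>h. h" lin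
  proof (rule tensor.intro)
    show "Vector_Spaces.linear (*s) (*s) (\<lambda>v :: vec3. v)"
      by (rule t1.linear_r')
    show "lin v \<in> ?U" for v using range by blast
  qed (use lin N N_lin minor_V linear_mat_component linear_vec_component lin_0 in auto)
  have plane_U: "plane_cubic cscale ?U det"
    unfolding plane_cubic_def
  proof (intro conjI)
    have "0 \<in> ?U" using W_subspace subspace_0 W_subset_complexification by blast
    then show "cscale.subspace ?U"
      unfolding cscale.subspace_def using comb[of _ _ 1] comb[of 0] by simp
    interpret pair: finite_dimensional_vector_space_pair_1 "(*s) :: complex \<Rightarrow> vec3 \<Rightarrow> vec3" cart_basis cscale
      by unfold_locales
    have "inj lin" using X_lin by (metis injI)
    then have "cscale.dim (range lin) = vec.dim (UNIV :: vec3 set)"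
      by (intro pair.dim_image_eq[OF lin]) (simp add: inj_on_subset)
    also have "\<dots> = 3" by (subst vec_dim_card) simp
    finally show "cscale.dim ?U = 3" by (simp add: range)
    show "homogeneous cscale 3 det"
      using homogeneous_det[OF t1.homogeneous_M] by (simp add: eval_nat_numeral)
    show "\<exists>x\<in>?U. det x \<noteq> 0"
      using W_det_nonzero W_subset_complexification by blast
  qed
  have plane_V: "plane_cubic (*s) UNIV (\<lambda>v. det (N v))"
    unfolding plane_cubic_def
  proof (intro conjI)
    show "vec.subspace (UNIV :: vec3 set)" by (rule vec.subspace_UNIV)
    show "vec.dim (UNIV :: vec3 set) = 3" by (subst vec_dim_card) simp
    show "homogeneous (*s) 3 (\<lambda>v. det (N v))"
      using homogeneous_det[OF t2.homogeneous_M] by (simp add: eval_nat_numeral)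
    show "\<exists>v\<in>UNIV. det (N v) \<noteq> 0"
    proof (rule ccontr)
      assume "\<not> ?thesis"
      \<comment> \<open>Then the images of \<open>v\<close> under three elements are images under
        the singular \<open>N v\<close>, so the space is locally dependent.\<close>
      then have G: "det (N v) = 0" for v by simp
      obtain h1 where h1: "h1 \<in> ?U" "det h1 \<noteq> 0"
        using W_det_nonzero W_subset_complexification by blast
      have dep: "trip (h *v v) (k *v v) (l *v v) = 0" if "h \<in> ?U" "k \<in> ?U" "l \<in> ?U" for h k l v
        using trip_matrix_mult[of "N v" "X h" "X k" "X l"] that by (simp add: G N_lin lin_X)
      have "\<exists>h\<in>?U. h \<noteq> 0 \<and> h *v v = 0" for v
      proof -
        obtain x where "x \<noteq> 0" "N v *v x = 0" using det_eq_0_imp_kernel[OF G] by blast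
        then show ?thesis using lin_0 N_lin range by (intro bexI[of _ "lin x"]) auto
      qed
      with rk.not_locally_dependent[OF h1 dep] show False by blast
    qed
  qed
  have "cubic_isomorphism cscale ?U det (*s) UNIV (\<lambda>v. det (N v)) focal_map"
    unfolding cubic_isomorphism_def
  proof (intro conjI plane_U plane_V exI)
    show "cubic_morphism cscale ?U det (*s) UNIV (\<lambda>v. det (N v)) t1.maps"
      by (rule t1.cubic_morphism_maps)
    show "cubic_morphism (*s) UNIV (\<lambda>v. det (N v)) cscale ?U det t2.maps"
      by (rule t2.cubic_morphism_maps)
    show "left_inverse_on_cubic cscale ?U det t2.maps t1.maps"
      unfolding left_inverse_on_cubic_def t1.maps_def t2.maps_def
      using t1.agree_at_inverse unfolding t2.\<phi>_def by fastforce
    show "left_inverse_on_cubic (*s) UNIV (\<lambda>v. det (N v)) t1.maps t2.maps"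
      unfolding left_inverse_on_cubic_def t1.maps_def t2.maps_def
      using t2.agree_at_inverse unfolding t1.\<phi>_def by fastforce
    \<comment> \<open>A nonzero column of the adjugate spans the kernel, which is the focus.\<close>
    show "\<forall>f\<in>t1.maps. \<forall>x\<in>?U - {0}. det x = 0 \<longrightarrow> f x \<noteq> 0 \<longrightarrow>
        focal_map (line cscale x) = line (*s) (f x)"
      unfolding t1.maps_def t1.\<phi>_def focal_map_complex_line
      using kernel_eq_line by blast
  qed
  then show ?thesis by (rule exI[of _ "\<lambda>v. det (N v)"])
qed

end

theorem lemma1p2p6:
  fixes H :: "vec3 \<Rightarrow> vec3 \<Rightarrow> complex" and W :: "mat3 set"
  assumes "hermitian_form H" and "signature_ppm H"
    and "generic_elliptic_family H W"
  shows "\<exists>G fhat.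
    cubic_isomorphism cscale (complexification W) det (*s) (UNIV :: vec3 set) G fhat \<and>
    (\<forall>h \<in> degenerate_part W - {0}. fhat (line cscale h) = focal_map (line scaleR h))"
proof -
  interpret generic_family H W
    using assms by unfold_locales
  obtain G where "cubic_isomorphism cscale (complexification W) det (*s) (UNIV :: vec3 set) G focal_map"
    using focal_map_extends by blast
  then show ?thesis
    by (intro exI[of _ G] exI[of _ focal_map]) (simp add: focal_map_complex_line focal_map_real_line)
qed

end
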